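(* Let $\mathbb{A}$ be a symmetric strict monoidal category and let $\mathcal{C}(\mathbb{A})$ be its free cornering. Then there is an isomorphism of categories $\mathbf{V}\,\mathcal{C}(\mathbb{A}) \cong \mathbb{A}$, where $\mathbf{V}\,\mathcal{C}(\mathbb{A})$ is the category of vertical cells of $\mathcal{C}(\mathbb{A})$.
   Context: Single-object double categories. A single-object double category $\mathbb{D}$ consists of a monoid $(\mathbb{D}_H,\otimes,I)$ of horizontal edges, a monoid $(\mathbb{D}_V,\otimes,I)$ of vertical edges, and cells $\alpha$, each with a top and a bottom boundary in $\mathbb{D}_H$ and a left and a right boundary in $\mathbb{D}_V$. If the right boundary of $\alpha$ equals the left boundary of $\beta$ there is a horizontal composite $\alpha\vert\beta$ (top/bottom boundaries are multiplied in the order $\alpha,\beta$; left boundary that of $\alpha$, right boundary that of $\beta$). If the bottom boundary of $\alpha$ equals the top boundary of $\beta$ there is a vertical composite $\frac{\alpha}{\beta}$ (left/right boundaries multiplied in the order $\alpha,\beta$; top that of $\alpha$, bottom that of $\beta$). Both compositions are associative and unital, with identity cells $1_A$ for $A\in\mathbb{D}_H$ (top $=$ bottom $=A$, left $=$ right $=I$; identities for vertical composition) and $1_X$ for $X\in\mathbb{D}_V$ (left $=$ right $=X$, top $=$ bottom $=I$; identities for horizontal composition), with $1_A\vert 1_B=1_{A\otimes B}$, $\frac{1_X}{1_Y}=1_{X\otimes Y}$, the two identity cells on $I$ coincide, and the interchange law $\frac{\alpha}{\beta}\big\vert\frac{\gamma}{\delta}=\frac{\alpha\vert\gamma}{\beta\vert\delta}$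 holds. Vertical cells. $\mathbf{V}\mathbb{D}$ is the strict monoidal category with object set $\mathbb{D}_H$, whose morphisms $A\to B$ are cells with top $A$, bottom $B$ and left and right boundary $I$; composition is vertical composition and tensor product is horizontal composition. Free cornering. For a symmetric strict monoidal category $\mathbb{A}$ (with object set $\mathbb{A}_0$), $\mathcal{C}(\mathbb{A})$ is the free single-object double category determined by: horizontal edge monoid $(\mathbb{A}_0,\otimes,I)$; vertical edge monoid the free monoid $\mathbb{A}^{\circ\bullet}=(\mathbb{A}_0\times\{\circ,\bullet\})^*$, with generators written $A^\circ$, $A^\bullet$, product written $\otimes$ and unit $I$; generating cells, for each $A\in\mathbb{A}_0$, the corners (boundaries not mentioned are $I$) - $s^\circ_A$: top $A$, right $A^\circ$; $\quad r^\circ_A$: left $A^\circ$, bottom $A$; - $s^\bullet_A$: top $A$, left $A^\bullet$; $\quad r^\bullet_A$: right $A^\bullet$, bottom $A$; and, for each morphism $f:A\to B$ of $\mathbb{A}$, a cell $\ulcorner f\urcorner$ with top $A$, bottom $B$; subject to the yanking equations $s^\circ_A\vert r^\circ_A=1_A$, $\frac{r^\circ_A}{s^\circ_A}=1_{A^\circ}$, $r^\bullet_A\vert s^\bullet_A=1_A$, $\frac{r^\bullet_A}{s^\bullet_A}=1_{A^\bullet}$, and the equations $\frac{\ulcorner f\urcorner}{\ulcorner g\urcorner}=\ulcorner f;g\urcorner$ (for composable $f,g$; $f;g$ is "first $f$ then $g$"), $\ulcorner 1_A\urcorner=1_A$, $\ulcorner f\urcorner\vert\ulcorner g\urcorner=\ulcorner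 f\otimes g\urcorner$. Thus cells are formed from generators and identities by the two compositions, modulo the double category axioms and these equations. *)

theory Defs
  imports "HOL-Algebra.Group"
begin

text \<open>Composition is written in diagrammatic order: \<open>f \<Zsemi> g\<close> is ``first \<open>f\<close>, then \<open>g\<close>''.\<close>

record ('o, 'a) category =
  Obj :: "'o set"
  Arr :: "'a set"
  Dom :: "'a \<Rightarrow> 'o"
  Cod :: "'a \<Rightarrow> 'o"
  Ident :: "'o \<Rightarrow> 'a"
  Comp :: "'a \<Rightarrow> 'a \<Rightarrow> 'a"  (infixl \<open>\<Zsemi>\<index>\<close> 65)

locale category =
  fixes C (structure)
  assumes dom_obj: "f \<in> Arr C \<Longrightarrow> Dom C f \<in> Obj C"
    and cod_obj: "f \<in> Arr C \<Longrightarrow> Cod C f \<in> Obj C"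
    and ident_arr: "A \<in> Obj C \<Longrightarrow> Ident C A \<in> Arr C"
    and ident_dom: "A \<in> Obj C \<Longrightarrow> Dom C (Ident C A) = A"
    and ident_cod: "A \<in> Obj C \<Longrightarrow> Cod C (Ident C A) = A"
    and comp_arr: "\<lbrakk>f \<in> Arr C; g \<in> Arr C; Cod C f = Dom C g\<rbrakk> \<Longrightarrow> f \<Zsemi> g \<in> Arr C"
    and comp_dom: "\<lbrakk>f \<in> Arr C; g \<in> Arr C; Cod C f = Dom C g\<rbrakk> \<Longrightarrow> Dom C (f \<Zsemi> g) = Dom C f"
    and comp_cod: "\<lbrakk>f \<in> Arr C; g \<in> Arr C; Cod C f = Dom C g\<rbrakk> \<Longrightarrow> Cod C (f \<Zsemi> g) = Cod C g"
    and comp_assoc: "\<lbrakk>f \<in> Arr C; g \<in> Arr C; h \<in> Arr C; Cod C f = Dom C g; Cod C g = Dom C h\<rbrakk>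
      \<Longrightarrow> (f \<Zsemi> g) \<Zsemi> h = f \<Zsemi> (g \<Zsemi> h)"
    and comp_ident_left: "f \<in> Arr C \<Longrightarrow> Ident C (Dom C f) \<Zsemi> f = f"
    and comp_ident_right: "f \<in> Arr C \<Longrightarrow> f \<Zsemi> Ident C (Cod C f) = f"

locale category_functor = C: category C + D: category D
  for C :: "('o1, 'a1, 'm1) category_scheme" and D :: "('o2, 'a2, 'm2) category_scheme" +
  fixes Fo :: "'o1 \<Rightarrow> 'o2" and Fa :: "'a1 \<Rightarrow> 'a2"
  assumes map_obj: "A \<in> Obj C \<Longrightarrow> Fo A \<in> Obj D"
    and map_arr: "f \<in> Arr C \<Longrightarrow> Fa f \<in> Arr D"
    and map_dom: "f \<in> Arr C \<Longrightarrow> Dom D (Fa f) = Fo (Dom C f)"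
    and map_cod: "f \<in> Arr C \<Longrightarrow> Cod D (Fa f) = Fo (Cod C f)"
    and map_ident: "A \<in> Obj C \<Longrightarrow> Fa (Ident C A) = Ident D (Fo A)"
    and map_comp: "\<lbrakk>f \<in> Arr C; g \<in> Arr C; Cod C f = Dom C g\<rbrakk>
      \<Longrightarrow> Fa (f \<Zsemi>\<^bsub>C\<^esub> g) = Fa f \<Zsemi>\<^bsub>D\<^esub> Fa g"

definition isomorphic_categories ::
    "('o1, 'a1, 'm1) category_scheme \<Rightarrow> ('o2, 'a2, 'm2) category_scheme \<Rightarrow> bool" where
  "isomorphic_categories C D \<longleftrightarrow>
    (\<exists>Fo Fa Go Ga. category_functor C D Fo Fa \<and> category_functor D C Go Ga \<and>
      (\<forall>A \<in> Obj C. Go (Fo A) = A) \<and> (\<forall>f \<in> Arr C. Ga (Fa f) = f) \<and>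
      (\<forall>B \<in> Obj D. Fo (Go B) = B) \<and> (\<forall>g \<in> Arr D. Fa (Ga g) = g))"

record ('o, 'a) monoidal_category = "('o, 'a) category" +
  tensor_obj :: "'o \<Rightarrow> 'o \<Rightarrow> 'o"
  unit_obj :: "'o"
  tensor_arr :: "'a \<Rightarrow> 'a \<Rightarrow> 'a"

record ('o, 'a) symmetric_monoidal_category = "('o, 'a) monoidal_category" +
  braid :: "'o \<Rightarrow> 'o \<Rightarrow> 'a"

definition object_monoid :: "('o, 'a, 'm) monoidal_category_scheme \<Rightarrow> 'o monoid" where
  "object_monoid M = \<lparr>carrier = Obj M, mult = tensor_obj M, one = unit_obj M\<rparr>"

locale strict_monoidal_category = category M
  for M :: "('o, 'a, 'm) monoidal_category_scheme" (structure) +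
  assumes monoid_objects: "monoid (object_monoid M)"
    and tensor_arr_closed: "\<lbrakk>f \<in> Arr M; g \<in> Arr M\<rbrakk> \<Longrightarrow> tensor_arr M f g \<in> Arr M"
    and tensor_arr_dom: "\<lbrakk>f \<in> Arr M; g \<in> Arr M\<rbrakk>
      \<Longrightarrow> Dom M (tensor_arr M f g) = tensor_obj M (Dom M f) (Dom M g)"
    and tensor_arr_cod: "\<lbrakk>f \<in> Arr M; g \<in> Arr M\<rbrakk>
      \<Longrightarrow> Cod M (tensor_arr M f g) = tensor_obj M (Cod M f) (Cod M g)"
    and tensor_ident: "\<lbrakk>A \<in> Obj M; B \<in> Obj M\<rbrakk>
      \<Longrightarrow> tensor_arr M (Ident M A) (Ident M B) = Ident M (tensor_obj M A B)"
    and tensor_comp: "\<lbrakk>f \<in> Arr M; g \<in> Arr M; f' \<in> Arr M; g' \<in> Arr M; Cod M f = Dom M g; Cod M f' = Dom M g'\<rbrakk>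
      \<Longrightarrow> tensor_arr M (f \<Zsemi> g) (f' \<Zsemi> g') = tensor_arr M f f' \<Zsemi> tensor_arr M g g'"
    and tensor_arr_assoc: "\<lbrakk>f \<in> Arr M; g \<in> Arr M; h \<in> Arr M\<rbrakk>
      \<Longrightarrow> tensor_arr M (tensor_arr M f g) h = tensor_arr M f (tensor_arr M g h)"
    and tensor_arr_unit_left: "f \<in> Arr M \<Longrightarrow> tensor_arr M (Ident M (unit_obj M)) f = f"
    and tensor_arr_unit_right: "f \<in> Arr M \<Longrightarrow> tensor_arr M f (Ident M (unit_obj M)) = f"

text \<open>The second hexagon and the coherence of the symmetry with the unit follow from
  the axioms below.\<close>

locale symmetric_strict_monoidal_category = strict_monoidal_category M
  for M :: "('o, 'a, 'm) symmetric_monoidal_category_scheme" (structure) +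
  assumes braid_arr: "\<lbrakk>A \<in> Obj M; B \<in> Obj M\<rbrakk> \<Longrightarrow> braid M A B \<in> Arr M"
    and braid_dom: "\<lbrakk>A \<in> Obj M; B \<in> Obj M\<rbrakk> \<Longrightarrow> Dom M (braid M A B) = tensor_obj M A B"
    and braid_cod: "\<lbrakk>A \<in> Obj M; B \<in> Obj M\<rbrakk> \<Longrightarrow> Cod M (braid M A B) = tensor_obj M B A"
    and braid_natural: "\<lbrakk>f \<in> Arr M; g \<in> Arr M\<rbrakk>
      \<Longrightarrow> tensor_arr M f g \<Zsemi> braid M (Cod M f) (Cod M g) =
          braid M (Dom M f) (Dom M g) \<Zsemi> tensor_arr M g f"
    and braid_symmetric: "\<lbrakk>A \<in> Obj M; B \<in> Obj M\<rbrakk>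
      \<Longrightarrow> braid M A B \<Zsemi> braid M B A = Ident M (tensor_obj M A B)"
    and braid_hexagon: "\<lbrakk>A \<in> Obj M; B \<in> Obj M; C \<in> Obj M\<rbrakk>
      \<Longrightarrow> braid M A (tensor_obj M B C) =
          tensor_arr M (braid M A B) (Ident M C) \<Zsemi> tensor_arr M (Ident M B) (braid M A C)"

record ('h, 'v, 'c) double_category =
  hedges :: "'h monoid"
  vedges :: "'v monoid"
  cells :: "'c set"
  top_edge :: "'c \<Rightarrow> 'h"
  bot_edge :: "'c \<Rightarrow> 'h"
  left_edge :: "'c \<Rightarrow> 'v"
  right_edge :: "'c \<Rightarrow> 'v"
  hident :: "'h \<Rightarrow> 'c"
  vident :: "'v \<Rightarrow> 'c"
  hcomp :: "'c \<Rightarrow> 'c \<Rightarrow> 'c"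
  vcomp :: "'c \<Rightarrow> 'c \<Rightarrow> 'c"

text \<open>Here \<open>hident D A\<close> is $1_A$ for a horizontal edge \<open>A\<close> (an identity for \<^emph>\<open>vertical\<close>
  composition), \<open>vident D X\<close> is $1_X$ for a vertical edge \<open>X\<close> (an identity for
  \<^emph>\<open>horizontal\<close> composition), \<open>hcomp D \<alpha> \<beta>\<close> is $\alpha | \beta$, and \<open>vcomp D \<alpha> \<beta>\<close> is
  $\frac{\alpha}{\beta}$.\<close>

locale single_object_double_category =
  fixes D :: "('h, 'v, 'c) double_category"
  assumes monoid_hedges: "monoid (hedges D)"
    and monoid_vedges: "monoid (vedges D)"
    and top_closed: "\<alpha> \<in> cells D \<Longrightarrow> top_edge D \<alpha> \<in> carrier (hedges D)"
    and bot_closed: "\<alpha> \<in> cells D \<Longrightarrow> bot_edge D \<alpha> \<in> carrier (hedges D)"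
    and left_closed: "\<alpha> \<in> cells D \<Longrightarrow> left_edge D \<alpha> \<in> carrier (vedges D)"
    and right_closed: "\<alpha> \<in> cells D \<Longrightarrow> right_edge D \<alpha> \<in> carrier (vedges D)"
    and hident_cell: "A \<in> carrier (hedges D) \<Longrightarrow>
      hident D A \<in> cells D \<and> top_edge D (hident D A) = A \<and> bot_edge D (hident D A) = A \<and>
      left_edge D (hident D A) = \<one>\<^bsub>vedges D\<^esub> \<and> right_edge D (hident D A) = \<one>\<^bsub>vedges D\<^esub>"
    and vident_cell: "X \<in> carrier (vedges D) \<Longrightarrow>
      vident D X \<in> cells D \<and> left_edge D (vident D X) = X \<and> right_edge D (vident D X) = X \<and>
      top_edge D (vident D X) = \<one>\<^bsub>hedges D\<^esub> \<and> bot_edge D (vident D X) = \<one>\<^bsub>hedges D\<^esub>"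
    and hcomp_cell: "\<lbrakk>\<alpha> \<in> cells D; \<beta> \<in> cells D; right_edge D \<alpha> = left_edge D \<beta>\<rbrakk> \<Longrightarrow>
      hcomp D \<alpha> \<beta> \<in> cells D \<and>
      top_edge D (hcomp D \<alpha> \<beta>) = top_edge D \<alpha> \<otimes>\<^bsub>hedges D\<^esub> top_edge D \<beta> \<and>
      bot_edge D (hcomp D \<alpha> \<beta>) = bot_edge D \<alpha> \<otimes>\<^bsub>hedges D\<^esub> bot_edge D \<beta> \<and>
      left_edge D (hcomp D \<alpha> \<beta>) = left_edge D \<alpha> \<and>
      right_edge D (hcomp D \<alpha> \<beta>) = right_edge D \<beta>"
    and vcomp_cell: "\<lbrakk>\<alpha> \<in> cells D; \<beta> \<in> cells D; bot_edge D \<alpha> = top_edge D \<beta>\<rbrakk> \<Longrightarrow>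
      vcomp D \<alpha> \<beta> \<in> cells D \<and>
      left_edge D (vcomp D \<alpha> \<beta>) = left_edge D \<alpha> \<otimes>\<^bsub>vedges D\<^esub> left_edge D \<beta> \<and>
      right_edge D (vcomp D \<alpha> \<beta>) = right_edge D \<alpha> \<otimes>\<^bsub>vedges D\<^esub> right_edge D \<beta> \<and>
      top_edge D (vcomp D \<alpha> \<beta>) = top_edge D \<alpha> \<and>
      bot_edge D (vcomp D \<alpha> \<beta>) = bot_edge D \<beta>"
    and hcomp_assoc: "\<lbrakk>\<alpha> \<in> cells D; \<beta> \<in> cells D; \<gamma> \<in> cells D;
        right_edge D \<alpha> = left_edge D \<beta>; right_edge D \<beta> = left_edge D \<gamma>\<rbrakk>
      \<Longrightarrow> hcomp D (hcomp D \<alpha> \<beta>) \<gamma> = hcomp D \<alpha> (hcomp D \<beta> \<gamma>)"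
    and vcomp_assoc: "\<lbrakk>\<alpha> \<in> cells D; \<beta> \<in> cells D; \<gamma> \<in> cells D;
        bot_edge D \<alpha> = top_edge D \<beta>; bot_edge D \<beta> = top_edge D \<gamma>\<rbrakk>
      \<Longrightarrow> vcomp D (vcomp D \<alpha> \<beta>) \<gamma> = vcomp D \<alpha> (vcomp D \<beta> \<gamma>)"
    and hcomp_ident_left: "\<alpha> \<in> cells D \<Longrightarrow> hcomp D (vident D (left_edge D \<alpha>)) \<alpha> = \<alpha>"
    and hcomp_ident_right: "\<alpha> \<in> cells D \<Longrightarrow> hcomp D \<alpha> (vident D (right_edge D \<alpha>)) = \<alpha>"
    and vcomp_ident_left: "\<alpha> \<in> cells D \<Longrightarrow> vcomp D (hident D (top_edge D \<alpha>)) \<alpha> = \<alpha>"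
    and vcomp_ident_right: "\<alpha> \<in> cells D \<Longrightarrow> vcomp D \<alpha> (hident D (bot_edge D \<alpha>)) = \<alpha>"
    and hident_mult: "\<lbrakk>A \<in> carrier (hedges D); B \<in> carrier (hedges D)\<rbrakk>
      \<Longrightarrow> hcomp D (hident D A) (hident D B) = hident D (A \<otimes>\<^bsub>hedges D\<^esub> B)"
    and vident_mult: "\<lbrakk>X \<in> carrier (vedges D); Y \<in> carrier (vedges D)\<rbrakk>
      \<Longrightarrow> vcomp D (vident D X) (vident D Y) = vident D (X \<otimes>\<^bsub>vedges D\<^esub> Y)"
    and ident_one: "hident D \<one>\<^bsub>hedges D\<^esub> = vident D \<one>\<^bsub>vedges D\<^esub>"
    and interchange: "\<lbrakk>\<alpha> \<in> cells D; \<beta> \<in> cells D; \<gamma> \<in> cells D; \<delta> \<in> cells D;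
        bot_edge D \<alpha> = top_edge D \<beta>; bot_edge D \<gamma> = top_edge D \<delta>;
        right_edge D \<alpha> = left_edge D \<gamma>; right_edge D \<beta> = left_edge D \<delta>\<rbrakk>
      \<Longrightarrow> hcomp D (vcomp D \<alpha> \<beta>) (vcomp D \<gamma> \<delta>) = vcomp D (hcomp D \<alpha> \<gamma>) (hcomp D \<beta> \<delta>)"

definition vertical_category ::
    "('h, 'v, 'c) double_category \<Rightarrow> ('h, 'c) monoidal_category" where
  "vertical_category D =
    \<lparr>Obj = carrier (hedges D),
     Arr = {\<alpha> \<in> cells D. left_edge D \<alpha> = \<one>\<^bsub>vedges D\<^esub> \<and> right_edge D \<alpha> = \<one>\<^bsub>vedges D\<^esub>},
     Dom = top_edge D,
     Cod = bot_edge D,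
     Ident = hident D,
     Comp = vcomp D,
     tensor_obj = mult (hedges D),
     unit_obj = one (hedges D),
     tensor_arr = hcomp D\<rparr>"

lemma (in single_object_double_category) strict_monoidal_vertical_category:
  "strict_monoidal_category (vertical_category D)"
proof -
  interpret H: monoid "hedges D" by (rule monoid_hedges)
  interpret V: monoid "vedges D" by (rule monoid_vedges)
  have "object_monoid (vertical_category D) = hedges D"
    by (simp add: object_monoid_def vertical_category_def)
  then have M: "monoid (object_monoid (vertical_category D))"
    by (simp add: monoid_hedges)
  show ?thesis
  proof (intro strict_monoidal_category.intro strict_monoidal_category_axioms.intro
      category.intro, goal_cases)
    case (19 f)
    then show ?case
      using hcomp_ident_left[of f] by (simp add: vertical_category_def ident_one)
  next
    case (20 f)
    then show ?case
      using hcomp_ident_right[of f] by (simp add: vertical_category_def ident_one)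
  qed (use M in \<open>simp_all add: vertical_category_def top_closed bot_closed hident_cell hcomp_cell
      vcomp_cell vcomp_assoc hcomp_assoc vcomp_ident_left vcomp_ident_right hident_mult interchange\<close>)
qed

datatype polarity = Circ | Bullet

type_synonym 'o exchange = "('o \<times> polarity) list"

text \<open>Raw expressions: \<open>SCirc A\<close>, \<open>RCirc A\<close>, \<open>SBullet A\<close>, \<open>RBullet A\<close> are the corners
  $s^\circ_A$, $r^\circ_A$, $s^\bullet_A$, $r^\bullet_A$, and \<open>Lift f\<close> is $\ulcorner f \urcorner$.
  Boundaries are only meaningful for expressions that satisfy \<open>wf_term\<close>.\<close>

datatype ('o, 'a) cell_term =
    SCirc 'o | RCirc 'o | SBullet 'o | RBullet 'o
  | Lift 'a
  | HIdent 'o | VIdent "'o exchange"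
  | HComp "('o, 'a) cell_term" "('o, 'a) cell_term"
  | VComp "('o, 'a) cell_term" "('o, 'a) cell_term"

primrec tm_top :: "('o, 'a, 'm) monoidal_category_scheme \<Rightarrow> ('o, 'a) cell_term \<Rightarrow> 'o" where
  "tm_top M (SCirc A) = A"
| "tm_top M (RCirc A) = unit_obj M"
| "tm_top M (SBullet A) = A"
| "tm_top M (RBullet A) = unit_obj M"
| "tm_top M (Lift f) = Dom M f"
| "tm_top M (HIdent A) = A"
| "tm_top M (VIdent X) = unit_obj M"
| "tm_top M (HComp s t) = tensor_obj M (tm_top M s) (tm_top M t)"
| "tm_top M (VComp s t) = tm_top M s"

primrec tm_bot :: "('o, 'a, 'm) monoidal_category_scheme \<Rightarrow> ('o, 'a) cell_term \<Rightarrow> 'o" where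
  "tm_bot M (SCirc A) = unit_obj M"
| "tm_bot M (RCirc A) = A"
| "tm_bot M (SBullet A) = unit_obj M"
| "tm_bot M (RBullet A) = A"
| "tm_bot M (Lift f) = Cod M f"
| "tm_bot M (HIdent A) = A"
| "tm_bot M (VIdent X) = unit_obj M"
| "tm_bot M (HComp s t) = tensor_obj M (tm_bot M s) (tm_bot M t)"
| "tm_bot M (VComp s t) = tm_bot M t"

primrec tm_left :: "('o, 'a) cell_term \<Rightarrow> 'o exchange" where
  "tm_left (SCirc A) = []"
| "tm_left (RCirc A) = [(A, Circ)]"
| "tm_left (SBullet A) = [(A, Bullet)]"
| "tm_left (RBullet A) = []"
| "tm_left (Lift f) = []"
| "tm_left (HIdent A) = []"
| "tm_left (VIdent X) = X"
| "tm_left (HComp s t) = tm_left s"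
| "tm_left (VComp s t) = tm_left s @ tm_left t"

primrec tm_right :: "('o, 'a) cell_term \<Rightarrow> 'o exchange" where
  "tm_right (SCirc A) = [(A, Circ)]"
| "tm_right (RCirc A) = []"
| "tm_right (SBullet A) = []"
| "tm_right (RBullet A) = [(A, Bullet)]"
| "tm_right (Lift f) = []"
| "tm_right (HIdent A) = []"
| "tm_right (VIdent X) = X"
| "tm_right (HComp s t) = tm_right t"
| "tm_right (VComp s t) = tm_right s @ tm_right t"

definition exchange_monoid :: "('o, 'a, 'm) monoidal_category_scheme \<Rightarrow> 'o exchange monoid" where
  "exchange_monoid M = \<lparr>carrier = lists (Obj M \<times> UNIV), mult = (@), one = []\<rparr>"

primrec wf_term :: "('o, 'a, 'm) monoidal_category_scheme \<Rightarrow> ('o, 'a) cell_term \<Rightarrow> bool" where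
  "wf_term M (SCirc A) \<longleftrightarrow> A \<in> Obj M"
| "wf_term M (RCirc A) \<longleftrightarrow> A \<in> Obj M"
| "wf_term M (SBullet A) \<longleftrightarrow> A \<in> Obj M"
| "wf_term M (RBullet A) \<longleftrightarrow> A \<in> Obj M"
| "wf_term M (Lift f) \<longleftrightarrow> f \<in> Arr M"
| "wf_term M (HIdent A) \<longleftrightarrow> A \<in> Obj M"
| "wf_term M (VIdent X) \<longleftrightarrow> X \<in> carrier (exchange_monoid M)"
| "wf_term M (HComp s t) \<longleftrightarrow> wf_term M s \<and> wf_term M t \<and> tm_right s = tm_left t"
| "wf_term M (VComp s t) \<longleftrightarrow> wf_term M s \<and> wf_term M t \<and> tm_bot M s = tm_top M t"

text \<open>The first group of rules makes \<open>cell_eq M\<close> a congruence on well-formed expressions, the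
  second consists of the axioms of a single-object double category, the last two of the
  yanking equations and the functoriality of $\ulcorner - \urcorner$.  In \<open>eq_interchange\<close> all
  four inner boundaries have to match: well-formedness of either side alone does not imply this,
  as only the products of the boundaries are compared there.\<close>

inductive cell_eq ::
    "('o, 'a, 'm) monoidal_category_scheme \<Rightarrow> ('o, 'a) cell_term \<Rightarrow> ('o, 'a) cell_term \<Rightarrow> bool"
  for M where
  eq_refl: "wf_term M s \<Longrightarrow> cell_eq M s s"
| eq_sym: "cell_eq M s t \<Longrightarrow> cell_eq M t s"
| eq_trans: "\<lbrakk>cell_eq M s t; cell_eq M t u\<rbrakk> \<Longrightarrow> cell_eq M s u"
| eq_hcomp: "\<lbrakk>cell_eq M s s'; cell_eq M t t'; wf_term M (HComp s t)\<rbrakk>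
    \<Longrightarrow> cell_eq M (HComp s t) (HComp s' t')"
| eq_vcomp: "\<lbrakk>cell_eq M s s'; cell_eq M t t'; wf_term M (VComp s t)\<rbrakk>
    \<Longrightarrow> cell_eq M (VComp s t) (VComp s' t')"

| eq_hcomp_assoc: "wf_term M (HComp (HComp s t) u)
    \<Longrightarrow> cell_eq M (HComp (HComp s t) u) (HComp s (HComp t u))"
| eq_vcomp_assoc: "wf_term M (VComp (VComp s t) u)
    \<Longrightarrow> cell_eq M (VComp (VComp s t) u) (VComp s (VComp t u))"
| eq_hcomp_ident_left: "wf_term M s \<Longrightarrow> cell_eq M (HComp (VIdent (tm_left s)) s) s"
| eq_hcomp_ident_right: "wf_term M s \<Longrightarrow> cell_eq M (HComp s (VIdent (tm_right s))) s"
| eq_vcomp_ident_left: "wf_term M s \<Longrightarrow> cell_eq M (VComp (HIdent (tm_top M s)) s) s"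
| eq_vcomp_ident_right: "wf_term M s \<Longrightarrow> cell_eq M (VComp s (HIdent (tm_bot M s))) s"
| eq_hident_mult: "\<lbrakk>A \<in> Obj M; B \<in> Obj M\<rbrakk>
    \<Longrightarrow> cell_eq M (HComp (HIdent A) (HIdent B)) (HIdent (tensor_obj M A B))"
| eq_vident_mult: "\<lbrakk>X \<in> carrier (exchange_monoid M); Y \<in> carrier (exchange_monoid M)\<rbrakk>
    \<Longrightarrow> cell_eq M (VComp (VIdent X) (VIdent Y)) (VIdent (X @ Y))"
| eq_ident_one: "cell_eq M (HIdent (unit_obj M)) (VIdent [])"
| eq_interchange: "\<lbrakk>wf_term M s; wf_term M t; wf_term M u; wf_term M v;
      tm_bot M s = tm_top M t; tm_bot M u = tm_top M v;
      tm_right s = tm_left u; tm_right t = tm_left v\<rbrakk>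
    \<Longrightarrow> cell_eq M (HComp (VComp s t) (VComp u v)) (VComp (HComp s u) (HComp t v))"

| yank_circ_h: "A \<in> Obj M \<Longrightarrow> cell_eq M (HComp (SCirc A) (RCirc A)) (HIdent A)"
| yank_circ_v: "A \<in> Obj M \<Longrightarrow> cell_eq M (VComp (RCirc A) (SCirc A)) (VIdent [(A, Circ)])"
| yank_bullet_h: "A \<in> Obj M \<Longrightarrow> cell_eq M (HComp (RBullet A) (SBullet A)) (HIdent A)"
| yank_bullet_v: "A \<in> Obj M \<Longrightarrow> cell_eq M (VComp (RBullet A) (SBullet A)) (VIdent [(A, Bullet)])"

| lift_comp: "\<lbrakk>f \<in> Arr M; g \<in> Arr M; Cod M f = Dom M g\<rbrakk>
    \<Longrightarrow> cell_eq M (VComp (Lift f) (Lift g)) (Lift (f \<Zsemi>\<^bsub>M\<^esub> g))"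
| lift_ident: "A \<in> Obj M \<Longrightarrow> cell_eq M (Lift (Ident M A)) (HIdent A)"
| lift_tensor: "\<lbrakk>f \<in> Arr M; g \<in> Arr M\<rbrakk>
    \<Longrightarrow> cell_eq M (HComp (Lift f) (Lift g)) (Lift (tensor_arr M f g))"

definition cell_class ::
    "('o, 'a, 'm) monoidal_category_scheme \<Rightarrow> ('o, 'a) cell_term \<Rightarrow> ('o, 'a) cell_term set" where
  "cell_class M s = {t. cell_eq M s t}"

definition cell_rep :: "('o, 'a) cell_term set \<Rightarrow> ('o, 'a) cell_term" where
  "cell_rep c = (SOME s. s \<in> c)"

text \<open>All operations are computed on representatives; they do not depend on the choice
  (see \<open>hcomp_cell_class\<close> etc. below).\<close>

definition free_cornering ::
    "('o, 'a, 'm) symmetric_monoidal_category_scheme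
      \<Rightarrow> ('o, 'o exchange, ('o, 'a) cell_term set) double_category" where
  "free_cornering M =
    \<lparr>hedges = object_monoid M,
     vedges = exchange_monoid M,
     cells = {cell_class M s |s. wf_term M s},
     top_edge = (\<lambda>c. tm_top M (cell_rep c)),
     bot_edge = (\<lambda>c. tm_bot M (cell_rep c)),
     left_edge = (\<lambda>c. tm_left (cell_rep c)),
     right_edge = (\<lambda>c. tm_right (cell_rep c)),
     hident = (\<lambda>A. cell_class M (HIdent A)),
     vident = (\<lambda>X. cell_class M (VIdent X)),
     hcomp = (\<lambda>c d. cell_class M (HComp (cell_rep c) (cell_rep d))),
     vcomp = (\<lambda>c d. cell_class M (VComp (cell_rep c) (cell_rep d)))\<rparr>"

lemma monoid_exchange_monoid: "monoid (exchange_monoid M)"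
  by (rule monoidI) (auto simp: exchange_monoid_def)

context strict_monoidal_category
begin

lemma tensor_obj_closed: "\<lbrakk>A \<in> Obj M; B \<in> Obj M\<rbrakk> \<Longrightarrow> tensor_obj M A B \<in> Obj M"
  using monoid.m_closed[OF monoid_objects] by (simp add: object_monoid_def)

lemma unit_obj_closed: "unit_obj M \<in> Obj M"
  using monoid.one_closed[OF monoid_objects] by (simp add: object_monoid_def)

lemma tensor_obj_assoc: "\<lbrakk>A \<in> Obj M; B \<in> Obj M; C \<in> Obj M\<rbrakk>
    \<Longrightarrow> tensor_obj M (tensor_obj M A B) C = tensor_obj M A (tensor_obj M B C)"
  using monoid.m_assoc[OF monoid_objects] by (simp add: object_monoid_def)

lemma tensor_obj_unit:
  "A \<in> Obj M \<Longrightarrow> tensor_obj M (unit_obj M) A = A"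
  "A \<in> Obj M \<Longrightarrow> tensor_obj M A (unit_obj M) = A"
  using monoid.l_one[OF monoid_objects] monoid.r_one[OF monoid_objects]
  by (simp_all add: object_monoid_def)

lemmas tensor_obj_simps =
  tensor_obj_closed unit_obj_closed tensor_obj_assoc tensor_obj_unit

lemma wf_term_boundaries:
  assumes "wf_term M s"
  shows "tm_top M s \<in> Obj M" "tm_bot M s \<in> Obj M"
    "tm_left s \<in> carrier (exchange_monoid M)" "tm_right s \<in> carrier (exchange_monoid M)"
  using assms
  by (induction s) (auto simp: exchange_monoid_def tensor_obj_simps dom_obj cod_obj)

lemma cell_eq_boundaries:
  assumes "cell_eq M s t"
  shows "wf_term M s \<and> wf_term M t \<and> tm_top M s = tm_top M t \<and> tm_bot M s = tm_bot M t \<and>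
    tm_left s = tm_left t \<and> tm_right s = tm_right t"
  using assms
proof induction
  case (eq_hcomp_ident_left s)
  then show ?case using wf_term_boundaries[of s] by (simp add: tensor_obj_simps)
next
  case (eq_hcomp_ident_right s)
  then show ?case using wf_term_boundaries[of s] by (simp add: tensor_obj_simps)
next
  case (eq_hcomp_assoc s t u)
  then show ?case
    using wf_term_boundaries[of s] wf_term_boundaries[of t] wf_term_boundaries[of u]
    by (simp add: tensor_obj_simps)
next
  case (eq_vcomp_ident_left s)
  then show ?case using wf_term_boundaries[of s] by simp
next
  case (eq_vcomp_ident_right s)
  then show ?case using wf_term_boundaries[of s] by simp
next
  case (eq_interchange s t u v)
  then show ?case
    using wf_term_boundaries[of s] wf_term_boundaries[of t] wf_term_boundaries[of u]
      wf_term_boundaries[of v]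
    by simp
qed (auto simp: exchange_monoid_def tensor_obj_simps ident_arr ident_dom ident_cod
    comp_arr comp_dom comp_cod tensor_arr_closed tensor_arr_dom tensor_arr_cod)

lemma cell_class_eq_iff:
  assumes "wf_term M s"
  shows "cell_class M s = cell_class M t \<longleftrightarrow> cell_eq M s t"
proof
  assume "cell_class M s = cell_class M t"
  then have "s \<in> cell_class M t" using assms by (auto simp: cell_class_def intro: eq_refl)
  then show "cell_eq M s t" by (auto simp: cell_class_def intro: eq_sym)
next
  assume "cell_eq M s t"
  then show "cell_class M s = cell_class M t"
    by (auto simp: cell_class_def intro: eq_sym eq_trans)
qed

lemma cell_rep_eq:
  assumes "wf_term M s"
  shows "cell_eq M s (cell_rep (cell_class M s))"
proof -
  have "s \<in> cell_class M s" using assms by (simp add: cell_class_def eq_refl)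
  then have "cell_rep (cell_class M s) \<in> cell_class M s" unfolding cell_rep_def by (rule someI)
  then show ?thesis by (simp add: cell_class_def)
qed

lemma cell_rep_boundaries:
  assumes "wf_term M s"
  shows "tm_top M (cell_rep (cell_class M s)) = tm_top M s"
    "tm_bot M (cell_rep (cell_class M s)) = tm_bot M s"
    "tm_left (cell_rep (cell_class M s)) = tm_left s"
    "tm_right (cell_rep (cell_class M s)) = tm_right s"
  using cell_eq_boundaries[OF cell_rep_eq[OF assms]] by simp_all

lemma hcomp_cell_class:
  assumes "wf_term M (HComp s t)"
  shows "cell_class M (HComp (cell_rep (cell_class M s)) (cell_rep (cell_class M t))) =
    cell_class M (HComp s t)"
  using cell_class_eq_iff[OF assms] assms
  by (metis cell_rep_eq eq_hcomp wf_term.simps(8))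

lemma vcomp_cell_class:
  assumes "wf_term M (VComp s t)"
  shows "cell_class M (VComp (cell_rep (cell_class M s)) (cell_rep (cell_class M t))) =
    cell_class M (VComp s t)"
  using cell_class_eq_iff[OF assms] assms
  by (metis cell_rep_eq eq_vcomp wf_term.simps(9))

end

context symmetric_strict_monoidal_category
begin

lemma cell_eq_imp_class_eq: "cell_eq M s t \<Longrightarrow> cell_class M s = cell_class M t"
  using cell_class_eq_iff cell_eq_boundaries by blast

lemma free_cornering_simps:
  "hedges (free_cornering M) = object_monoid M"
  "vedges (free_cornering M) = exchange_monoid M"
  "hident (free_cornering M) A = cell_class M (HIdent A)"
  "vident (free_cornering M) X = cell_class M (VIdent X)"
  "wf_term M s \<Longrightarrow> cell_class M s \<in> cells (free_cornering M)"
  "wf_term M s \<Longrightarrow> top_edge (free_cornering M) (cell_class M s) = tm_top M s"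
  "wf_term M s \<Longrightarrow> bot_edge (free_cornering M) (cell_class M s) = tm_bot M s"
  "wf_term M s \<Longrightarrow> left_edge (free_cornering M) (cell_class M s) = tm_left s"
  "wf_term M s \<Longrightarrow> right_edge (free_cornering M) (cell_class M s) = tm_right s"
  "wf_term M (HComp s t) \<Longrightarrow>
    hcomp (free_cornering M) (cell_class M s) (cell_class M t) = cell_class M (HComp s t)"
  "wf_term M (VComp s t) \<Longrightarrow>
    vcomp (free_cornering M) (cell_class M s) (cell_class M t) = cell_class M (VComp s t)"
  using hcomp_cell_class[of s t] vcomp_cell_class[of s t] cell_rep_boundaries[of s]
  by (auto simp: free_cornering_def)

lemma free_cornering_cellE:
  assumes "c \<in> cells (free_cornering M)"
  obtains s where "wf_term M s" "c = cell_class M s"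
  using assms by (auto simp: free_cornering_def)

lemma single_object_double_category_free_cornering:
  "single_object_double_category (free_cornering M)"
proof -
  have e: "carrier (exchange_monoid M) = lists (Obj M \<times> UNIV)"
    "mult (exchange_monoid M) = (@)" "one (exchange_monoid M) = []"
    "carrier (object_monoid M) = Obj M"
    "mult (object_monoid M) = tensor_obj M" "one (object_monoid M) = unit_obj M"
    by (simp_all add: exchange_monoid_def object_monoid_def)
  note w = wf_term_boundaries[unfolded e]
  note simps = free_cornering_simps e w tensor_obj_simps
  show ?thesis
  proof (rule single_object_double_category.intro, goal_cases)
    case 1
    then show ?case by (simp add: free_cornering_simps monoid_objects)
  next
    case 2
    then show ?case by (simp add: free_cornering_simps monoid_exchange_monoid)
  next
    case (11 \<alpha> \<beta> \<gamma>)
    then show ?case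
      by (elim free_cornering_cellE) (simp add: simps cell_eq_imp_class_eq[OF eq_hcomp_assoc])
  next
    case (12 \<alpha> \<beta> \<gamma>)
    then show ?case
      by (elim free_cornering_cellE) (simp add: simps cell_eq_imp_class_eq[OF eq_vcomp_assoc])
  next
    case (13 \<alpha>)
    then show ?case
      by (elim free_cornering_cellE) (simp add: simps cell_eq_imp_class_eq[OF eq_hcomp_ident_left])
  next
    case (14 \<alpha>)
    then show ?case
      by (elim free_cornering_cellE) (simp add: simps cell_eq_imp_class_eq[OF eq_hcomp_ident_right])
  next
    case (15 \<alpha>)
    then show ?case
      by (elim free_cornering_cellE) (simp add: simps cell_eq_imp_class_eq[OF eq_vcomp_ident_left])
  next
    case (16 \<alpha>)
    then show ?case
      by (elim free_cornering_cellE) (simp add: simps cell_eq_imp_class_eq[OF eq_vcomp_ident_right])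
  next
    case (17 A B)
    then show ?case by (simp add: simps cell_eq_imp_class_eq[OF eq_hident_mult])
  next
    case (18 X Y)
    then show ?case by (simp add: simps cell_eq_imp_class_eq[OF eq_vident_mult])
  next
    case 19
    then show ?case by (simp add: simps cell_eq_imp_class_eq[OF eq_ident_one])
  next
    case (20 \<alpha> \<beta> \<gamma> \<delta>)
    then show ?case
      by (elim free_cornering_cellE) (simp add: simps cell_eq_imp_class_eq[OF eq_interchange])
  qed ((elim free_cornering_cellE)?, simp add: simps)+
qed

end

end

theory Submission
  imports Defs
begin

text \<open>Cells act on copresheaves \<open>P\<close> on \<open>M\<close>.  A horizontal edge \<open>A\<close> acts by
  \<open>(P \<cdot> A) X = P (A \<otimes> X)\<close>, a strict right action in which every \<open>- \<cdot> A\<close> has a right adjoint \<open>R\<^sub>A\<close>.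
  Reading a vertical edge as an endofunctor \<open>G\<close>, with $A^\circ$ as \<open>- \<cdot> A\<close> and $A^\bullet$ as \<open>R\<^sub>A\<close>,
  a cell with boundaries \<open>A, B, U, V\<close> (top, bottom, left, right) becomes a transformation
  \<open>(G\<^sub>U P) \<cdot> A \<rightarrow> G\<^sub>V (P \<cdot> B)\<close> natural in \<open>P\<close>: the circle corners are identities, the bullet corners are
  the unit and counit of the adjunction, and naturality in \<open>P\<close> gives the interchange law.  At the
  representable copresheaf the interpretation of $\ulcorner f \urcorner$ returns \<open>f\<close>, so
  $\ulcorner - \urcorner$ is faithful.

  For fullness, let \<open>P X\<close> be the set of vertical cells with top \<open>A\<close> and bottom \<open>X\<close>.  Probing a function
  on cells by corners gives an element of \<open>G\<^sub>U P\<close>, and induction on cells shows that interpretation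
  corresponds to horizontal composition under this probing.  Hence a vertical cell \<open>s\<close> sends the identity
  in \<open>P A\<close> to \<open>s\<close>; naturality along $\ulcorner - \urcorner$ from the representable copresheaf to \<open>P\<close>
  exhibits \<open>s\<close> as some $\ulcorner f \urcorner$.\<close>

section \<open>Elements as functions on lists of tests\<close>

text \<open>Right adjoints turn elements into families of elements indexed by tests \<open>(Y, h)\<close>.  Functions on
  lists of tests are a single type closed under this operation, which HOL needs since the number of
  iterations depends on the vertical edge.\<close>

type_synonym ('o, 'a, 'b) element = "('o \<times> 'a) list \<Rightarrow> 'b"

definition feed :: "('o, 'a, 'b) element \<Rightarrow> 'o \<times> 'a \<Rightarrow> ('o, 'a, 'b) element" where
  "feed x p = (\<lambda>l. x (p # l))"

text \<open>The default \<open>undefined\<close> on the empty list and outside \<open>S\<close>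
  makes families extensional: an \<open>x\<close> with \<open>x = collect S (feed x)\<close> is
  determined by its members at the tests in \<open>S\<close>.\<close>

definition collect :: "('o \<times> 'a) set \<Rightarrow> ('o \<times> 'a \<Rightarrow> ('o, 'a, 'b) element) \<Rightarrow> ('o, 'a, 'b) element" where
  "collect S F = (\<lambda>l. case l of [] \<Rightarrow> undefined | p # l' \<Rightarrow> if p \<in> S then F p l' else undefined)"

lemma feed_collect [simp]: "p \<in> S \<Longrightarrow> feed (collect S F) p = F p"
  by (simp add: feed_def collect_def)

lemma collect_cong: "(\<And>p. p \<in> S \<Longrightarrow> F p = G p) \<Longrightarrow> collect S F = collect S G"
  by (auto simp: collect_def split: list.split)

lemma collect_eqI:
  assumes "x = collect S (feed x)" "\<And>p. p \<in> S \<Longrightarrow> F p = feed x p"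
  shows "collect S F = x"
  using assms(1) collect_cong[of S F "feed x"] assms(2) by simp

lemma collect_feed_collect [simp]: "collect S (feed (collect S F)) = collect S F"
  by (rule collect_cong) simp

section \<open>Copresheaves on \<open>M\<close> and the action of horizontal edges\<close>

text \<open>The value type \<open>'b\<close> stays a parameter because fullness compares a
  copresheaf of morphisms with one of classes of cells.\<close>

record ('o, 'a, 'b) copresheaf =
  Elts :: "'o \<Rightarrow> ('o, 'a, 'b) element set"
  act :: "'a \<Rightarrow> ('o, 'a, 'b) element \<Rightarrow> ('o, 'a, 'b) element"

context strict_monoidal_category
begin

lemmas cat_simps = dom_obj cod_obj ident_arr ident_dom ident_cod comp_arr comp_dom comp_cod
  comp_ident_left comp_ident_right tensor_arr_closed tensor_arr_dom tensor_arr_cod tensor_ident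
  tensor_arr_unit_left tensor_arr_unit_right tensor_obj_simps

definition whisker :: "'o \<Rightarrow> 'a \<Rightarrow> 'a" where
  "whisker A f = tensor_arr M (Ident M A) f"

lemma whisker_simps:
  assumes "A \<in> Obj M" "f \<in> Arr M"
  shows "whisker A f \<in> Arr M" "Dom M (whisker A f) = tensor_obj M A (Dom M f)"
    "Cod M (whisker A f) = tensor_obj M A (Cod M f)"
  using assms by (simp_all add: whisker_def cat_simps)

lemma whisker_unit: "f \<in> Arr M \<Longrightarrow> whisker (unit_obj M) f = f"
  by (simp add: whisker_def cat_simps)

lemma whisker_ident: "\<lbrakk>A \<in> Obj M; B \<in> Obj M\<rbrakk>
    \<Longrightarrow> whisker A (Ident M B) = Ident M (tensor_obj M A B)"
  by (simp add: whisker_def cat_simps)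

lemma whisker_whisker: "\<lbrakk>A \<in> Obj M; B \<in> Obj M; f \<in> Arr M\<rbrakk>
    \<Longrightarrow> whisker A (whisker B f) = whisker (tensor_obj M A B) f"
  using tensor_arr_assoc[of "Ident M A" "Ident M B" f] by (simp add: whisker_def cat_simps)

lemma whisker_comp: "\<lbrakk>A \<in> Obj M; f \<in> Arr M; g \<in> Arr M; Cod M f = Dom M g\<rbrakk>
    \<Longrightarrow> whisker A (f \<Zsemi> g) = whisker A f \<Zsemi> whisker A g"
  using tensor_comp[of "Ident M A" "Ident M A" f g] comp_ident_left[of "Ident M A"]
  by (simp add: whisker_def cat_simps)

text \<open>Both sides are \<open>tensor_arr M f g\<close>, by functoriality of the tensor. This is
  what makes acting by \<open>f\<close> on the left factor natural in the remaining factor.\<close>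

lemma tensor_slide:
  assumes "f \<in> Arr M" "g \<in> Arr M"
  shows "tensor_arr M f (Ident M (Dom M g)) \<Zsemi> whisker (Cod M f) g =
    whisker (Dom M f) g \<Zsemi> tensor_arr M f (Ident M (Cod M g))"
  using assms tensor_comp[of f "Ident M (Cod M f)" "Ident M (Dom M g)" g]
    tensor_comp[of "Ident M (Dom M f)" f g "Ident M (Cod M g)"]
  by (simp add: whisker_def cat_simps)

text \<open>Fixing the values outside \<open>Obj M\<close> and \<open>Arr M\<close> makes \<open>shift_shift\<close> and \<open>shift_unit\<close> equations
  between records.\<close>

definition is_copresheaf :: "('o, 'a, 'b) copresheaf \<Rightarrow> bool" where
  "is_copresheaf P \<longleftrightarrow>
    (\<forall>X. X \<notin> Obj M \<longrightarrow> Elts P X = {}) \<and> (\<forall>m. m \<notin> Arr M \<longrightarrow> act P m = undefined) \<and>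
    (\<forall>m \<in> Arr M. \<forall>x \<in> Elts P (Dom M m). act P m x \<in> Elts P (Cod M m)) \<and>
    (\<forall>X \<in> Obj M. \<forall>x \<in> Elts P X. act P (Ident M X) x = x) \<and>
    (\<forall>m \<in> Arr M. \<forall>n \<in> Arr M. \<forall>x \<in> Elts P (Dom M m). Cod M m = Dom M n \<longrightarrow>
      act P (m \<Zsemi> n) x = act P n (act P m x))"

lemma copresheafD:
  assumes "is_copresheaf P"
  shows "X \<notin> Obj M \<Longrightarrow> Elts P X = {}" "m \<notin> Arr M \<Longrightarrow> act P m = undefined"
    "\<lbrakk>m \<in> Arr M; x \<in> Elts P X; Dom M m = X; Cod M m = Y\<rbrakk> \<Longrightarrow> act P m x \<in> Elts P Y"
    "\<lbrakk>X \<in> Obj M; x \<in> Elts P X\<rbrakk> \<Longrightarrow> act P (Ident M X) x = x"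
    "\<lbrakk>m \<in> Arr M; n \<in> Arr M; x \<in> Elts P X; Dom M m = X; Cod M m = Dom M n\<rbrakk>
      \<Longrightarrow> act P (m \<Zsemi> n) x = act P n (act P m x)"
  using assms unfolding is_copresheaf_def by blast+

definition shift :: "'o \<Rightarrow> ('o, 'a, 'b) copresheaf \<Rightarrow> ('o, 'a, 'b) copresheaf" where
  "shift A P =
    \<lparr>Elts = (\<lambda>X. if X \<in> Obj M then Elts P (tensor_obj M A X) else {}),
     act = (\<lambda>m. if m \<in> Arr M then act P (whisker A m) else undefined)\<rparr>"

lemma shift_simps [simp]:
  "X \<in> Obj M \<Longrightarrow> Elts (shift A P) X = Elts P (tensor_obj M A X)"
  "m \<in> Arr M \<Longrightarrow> act (shift A P) m = act P (whisker A m)"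
  by (simp_all add: shift_def)

lemma is_copresheaf_shift:
  assumes "A \<in> Obj M" "is_copresheaf P"
  shows "is_copresheaf (shift A P)"
  unfolding is_copresheaf_def using assms(1) copresheafD[OF assms(2)]
  by (auto simp: cat_simps whisker_simps whisker_ident whisker_comp shift_def)

lemma shift_shift:
  assumes "A \<in> Obj M" "B \<in> Obj M"
  shows "shift B (shift A P) = shift (tensor_obj M A B) P"
  using assms by (auto simp: shift_def fun_eq_iff cat_simps whisker_simps whisker_whisker)

lemma shift_unit:
  assumes "is_copresheaf P"
  shows "shift (unit_obj M) P = P"
proof (rule copresheaf.equality)
  show "Elts (shift (unit_obj M) P) = Elts P"
  proof
    show "Elts (shift (unit_obj M) P) X = Elts P X" for X
      using copresheafD(1)[OF assms, of X] by (cases "X \<in> Obj M") (auto simp: shift_def cat_simps)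
  qed
  show "act (shift (unit_obj M) P) = act P"
  proof
    show "act (shift (unit_obj M) P) m = act P m" for m
      using copresheafD(2)[OF assms, of m] by (cases "m \<in> Arr M") (auto simp: shift_def whisker_unit)
  qed
qed simp

section \<open>The right adjoint of \<open>shift\<close>\<close>

definition tests :: "'o \<Rightarrow> 'o \<Rightarrow> ('o \<times> 'a) set" where
  "tests A X = {(Y, h). Y \<in> Obj M \<and> h \<in> Arr M \<and> Dom M h = X \<and> Cod M h = tensor_obj M A Y}"

text \<open>The right adjoint of \<open>shift A\<close> (a right Kan extension): natural families
  \<open>(h : X \<rightarrow> A \<otimes> Y) \<mapsto> P Y\<close>.\<close>

definition coshift :: "'o \<Rightarrow> ('o, 'a, 'b) copresheaf \<Rightarrow> ('o, 'a, 'b) copresheaf" where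
  "coshift A P =
    \<lparr>Elts = (\<lambda>X. if X \<in> Obj M then
        {x. x = collect (tests A X) (feed x) \<and>
          (\<forall>(Y, h) \<in> tests A X. feed x (Y, h) \<in> Elts P Y \<and>
            (\<forall>k \<in> Arr M. Dom M k = Y \<longrightarrow>
              feed x (Cod M k, h \<Zsemi> whisker A k) = act P k (feed x (Y, h))))} else {}),
     act = (\<lambda>m. if m \<in> Arr M then
        (\<lambda>x. collect (tests A (Cod M m)) (\<lambda>(Y, h). feed x (Y, m \<Zsemi> h))) else undefined)\<rparr>"

lemma coshift_act: "m \<in> Arr M \<Longrightarrow>
    act (coshift A P) m x = collect (tests A (Cod M m)) (\<lambda>(Y, h). feed x (Y, m \<Zsemi> h))"
  by (simp add: coshift_def)

lemma coshift_eltD: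
  assumes "x \<in> Elts (coshift A P) X"
  shows "X \<in> Obj M" "x = collect (tests A X) (feed x)"
    "(Y, h) \<in> tests A X \<Longrightarrow> feed x (Y, h) \<in> Elts P Y"
    "\<lbrakk>(Y, h) \<in> tests A X; k \<in> Arr M; Dom M k = Y; Cod M k = Z\<rbrakk>
      \<Longrightarrow> feed x (Z, h \<Zsemi> whisker A k) = act P k (feed x (Y, h))"
  using assms by (auto simp: coshift_def split: if_splits)

lemma coshift_collectI:
  assumes "X \<in> Obj M"
    "\<And>Y h. (Y, h) \<in> tests A X \<Longrightarrow> F (Y, h) \<in> Elts P Y"
    "\<And>Y h k. \<lbrakk>(Y, h) \<in> tests A X; k \<in> Arr M; Dom M k = Y; (Cod M k, h \<Zsemi> whisker A k) \<in> tests A X\<rbrakk>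
      \<Longrightarrow> F (Cod M k, h \<Zsemi> whisker A k) = act P k (F (Y, h))"
    and A: "A \<in> Obj M"
  shows "collect (tests A X) F \<in> Elts (coshift A P) X"
proof -
  have "(Cod M k, h \<Zsemi> whisker A k) \<in> tests A X"
    if "(Y, h) \<in> tests A X" "k \<in> Arr M" "Dom M k = Y" for Y h k
    using that A by (auto simp: tests_def cat_simps whisker_simps)
  then show ?thesis using assms by (auto simp: coshift_def)
qed

lemma tests_precomp:
  assumes "A \<in> Obj M" "(Y, h) \<in> tests A (Cod M m)" "m \<in> Arr M"
  shows "(Y, m \<Zsemi> h) \<in> tests A (Dom M m)"
  using assms by (auto simp: tests_def cat_simps)

text \<open>The universal test: evaluating a family here is the counit of the adjunction.\<close>

lemma tests_ident: "\<lbrakk>A \<in> Obj M; X \<in> Obj M\<rbrakk>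
    \<Longrightarrow> (X, Ident M (tensor_obj M A X)) \<in> tests A (tensor_obj M A X)"
  by (simp add: tests_def cat_simps)

lemma is_copresheaf_coshift:
  assumes A: "A \<in> Obj M" and P: "is_copresheaf P"
  shows "is_copresheaf (coshift A P)"
  unfolding is_copresheaf_def
proof (intro conjI allI ballI impI)
  fix X assume "X \<notin> Obj M" then show "Elts (coshift A P) X = {}" by (simp add: coshift_def)
next
  fix m assume "m \<notin> Arr M" then show "act (coshift A P) m = undefined" by (simp add: coshift_def)
next
  fix m x assume m: "m \<in> Arr M" and x: "x \<in> Elts (coshift A P) (Dom M m)"
  show "act (coshift A P) m x \<in> Elts (coshift A P) (Cod M m)"
    unfolding coshift_act[OF m]
  proof (rule coshift_collectI)
    fix Y h k assume h: "(Y, h) \<in> tests A (Cod M m)" and k: "k \<in> Arr M" "Dom M k = Y"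
    have "m \<Zsemi> (h \<Zsemi> whisker A k) = (m \<Zsemi> h) \<Zsemi> whisker A k"
      using h k m A by (auto simp: tests_def comp_assoc whisker_simps)
    then show "(case (Cod M k, h \<Zsemi> whisker A k) of (Y, h) \<Rightarrow> feed x (Y, m \<Zsemi> h)) =
        act P k (case (Y, h) of (Y, h) \<Rightarrow> feed x (Y, m \<Zsemi> h))"
      using coshift_eltD(4)[OF x tests_precomp[OF A h m] k refl] by simp
  qed (use m A coshift_eltD(3)[OF x tests_precomp[OF A _ m]] in \<open>simp_all add: cat_simps\<close>)
next
  fix X x assume X: "X \<in> Obj M" and x: "x \<in> Elts (coshift A P) X"
  have "Ident M X \<Zsemi> h = h" if "(Y, h) \<in> tests A X" for Y h
    using that by (auto simp: tests_def cat_simps)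
  then show "act (coshift A P) (Ident M X) x = x"
    using X by (auto simp: coshift_act cat_simps intro!: collect_eqI[OF coshift_eltD(2)[OF x]])
next
  fix m n x assume m: "m \<in> Arr M" and n: "n \<in> Arr M" and mn: "Cod M m = Dom M n"
    and x: "x \<in> Elts (coshift A P) (Dom M m)"
  have "(m \<Zsemi> n) \<Zsemi> h = m \<Zsemi> (n \<Zsemi> h)" if "(Y, h) \<in> tests A (Cod M n)" for Y h
    using that m n mn by (auto simp: tests_def comp_assoc)
  then show "act (coshift A P) (m \<Zsemi> n) x = act (coshift A P) n (act (coshift A P) m x)"
    using m n mn tests_precomp[OF A _ n]
    by (auto simp: coshift_act cat_simps intro!: collect_cong)
qed

section \<open>Vertical edges as endofunctors; natural transformations\<close>

text \<open>The endofunctor of a vertical edge. The first letter, topmost on the wall, acts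
  outermost, so concatenation of walls becomes composition of functors.\<close>

primrec along :: "'o exchange \<Rightarrow> ('o, 'a, 'b) copresheaf \<Rightarrow> ('o, 'a, 'b) copresheaf" where
  "along [] P = P"
| "along (a # U) P =
    (case snd a of Circ \<Rightarrow> shift (fst a) (along U P) | Bullet \<Rightarrow> coshift (fst a) (along U P))"

text \<open>The same endofunctor on transformations: a circle whiskers the object, a bullet applies
  the transformation to each member of the family.\<close>

primrec along_map :: "'o exchange \<Rightarrow> ('o \<Rightarrow> ('o, 'a, 'b) element \<Rightarrow> ('o, 'a, 'c) element)
    \<Rightarrow> 'o \<Rightarrow> ('o, 'a, 'b) element \<Rightarrow> ('o, 'a, 'c) element" where
  "along_map [] \<theta> = \<theta>"
| "along_map (a # U) \<theta> = (\<lambda>X x. case snd a of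
      Circ \<Rightarrow> along_map U \<theta> (tensor_obj M (fst a) X) x
    | Bullet \<Rightarrow> collect (tests (fst a) X) (\<lambda>(Y, h). along_map U \<theta> Y (feed x (Y, h))))"

lemma along_append: "along (U @ V) P = along U (along V P)"
  by (induction U) (simp_all cong: polarity.case_cong)

lemma along_map_append: "along_map (U @ V) \<theta> = along_map U (along_map V \<theta>)"
  by (induction U) (simp_all cong: polarity.case_cong)

abbreviation walls :: "'o exchange set" where
  "walls \<equiv> lists (Obj M \<times> UNIV)"

lemma wall_cases:
  assumes "a # U \<in> walls"
  obtains A where "a = (A, Circ)" "A \<in> Obj M" "U \<in> walls"
  | A where "a = (A, Bullet)" "A \<in> Obj M" "U \<in> walls"
  using assms by (cases a; cases "snd a") auto

lemma is_copresheaf_along: "\<lbrakk>U \<in> walls; is_copresheaf P\<rbrakk> \<Longrightarrow> is_copresheaf (along U P)"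
proof (induction U)
  case (Cons a U)
  from Cons.prems(1) Cons show ?case
    by (cases rule: wall_cases) (simp_all add: is_copresheaf_shift is_copresheaf_coshift)
qed simp

definition natural :: "('o, 'a, 'b) copresheaf \<Rightarrow> ('o, 'a, 'c) copresheaf
    \<Rightarrow> ('o \<Rightarrow> ('o, 'a, 'b) element \<Rightarrow> ('o, 'a, 'c) element) \<Rightarrow> bool" where
  "natural P Q \<theta> \<longleftrightarrow>
    (\<forall>X \<in> Obj M. \<forall>x \<in> Elts P X. \<theta> X x \<in> Elts Q X) \<and>
    (\<forall>m \<in> Arr M. \<forall>x \<in> Elts P (Dom M m). \<theta> (Cod M m) (act P m x) = act Q m (\<theta> (Dom M m) x))"

lemma naturalD:
  assumes "natural P Q \<theta>"
  shows "\<lbrakk>X \<in> Obj M; x \<in> Elts P X\<rbrakk> \<Longrightarrow> \<theta> X x \<in> Elts Q X"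
    "\<lbrakk>m \<in> Arr M; x \<in> Elts P X; Dom M m = X; Cod M m = Y\<rbrakk> \<Longrightarrow> \<theta> Y (act P m x) = act Q m (\<theta> X x)"
  using assms by (auto simp: natural_def)

lemma natural_shift:
  assumes "natural P Q \<theta>" "A \<in> Obj M"
  shows "natural (shift A P) (shift A Q) (\<lambda>X. \<theta> (tensor_obj M A X))"
  using assms(2) naturalD[OF assms(1)] by (auto simp: natural_def cat_simps whisker_simps)

lemma natural_coshift:
  assumes \<theta>: "natural P Q \<theta>" and A: "A \<in> Obj M"
  shows "natural (coshift A P) (coshift A Q)
    (\<lambda>X x. collect (tests A X) (\<lambda>(Y, h). \<theta> Y (feed x (Y, h))))"
  unfolding natural_def
proof (intro conjI ballI)
  fix X x assume X: "X \<in> Obj M" and x: "x \<in> Elts (coshift A P) X"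
  show "collect (tests A X) (\<lambda>(Y, h). \<theta> Y (feed x (Y, h))) \<in> Elts (coshift A Q) X"
  proof (rule coshift_collectI[OF X _ _ A])
    fix Y h assume h: "(Y, h) \<in> tests A X"
    then have Y: "Y \<in> Obj M" by (simp add: tests_def)
    show "(case (Y, h) of (Y, h) \<Rightarrow> \<theta> Y (feed x (Y, h))) \<in> Elts Q Y"
      using naturalD(1)[OF \<theta> Y coshift_eltD(3)[OF x h]] by simp
    fix k assume k: "k \<in> Arr M" "Dom M k = Y"
    show "(case (Cod M k, h \<Zsemi> whisker A k) of (Y, h) \<Rightarrow> \<theta> Y (feed x (Y, h))) =
        act Q k (case (Y, h) of (Y, h) \<Rightarrow> \<theta> Y (feed x (Y, h)))"
      using naturalD(2)[OF \<theta> k(1) coshift_eltD(3)[OF x h] k(2)] coshift_eltD(4)[OF x h k refl]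
      by simp
  qed
next
  fix m x assume m: "m \<in> Arr M" and x: "x \<in> Elts (coshift A P) (Dom M m)"
  show "collect (tests A (Cod M m)) (\<lambda>(Y, h). \<theta> Y (feed (act (coshift A P) m x) (Y, h))) =
      act (coshift A Q) m (collect (tests A (Dom M m)) (\<lambda>(Y, h). \<theta> Y (feed x (Y, h))))"
    using m tests_precomp[OF A _ m] by (auto simp: coshift_act intro!: collect_cong)
qed

lemma natural_along_map:
  assumes "natural P Q \<theta>"
  shows "U \<in> walls \<Longrightarrow> natural (along U P) (along U Q) (along_map U \<theta>)"
proof (induction U)
  case (Cons a U)
  from Cons.prems show ?case
  proof (cases rule: wall_cases)
    case (1 A)
    then show ?thesis using natural_shift[OF Cons.IH] by simp
  next
    case (2 A)
    then show ?thesis using natural_coshift[OF Cons.IH] by simp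
  qed
qed (simp add: assms)

lemma along_map_cong:
  assumes "\<And>X x. \<lbrakk>X \<in> Obj M; x \<in> Elts P X\<rbrakk> \<Longrightarrow> \<theta> X x = \<theta>' X x"
  shows "\<lbrakk>U \<in> walls; X \<in> Obj M; x \<in> Elts (along U P) X\<rbrakk> \<Longrightarrow> along_map U \<theta> X x = along_map U \<theta>' X x"
proof (induction U arbitrary: X x)
  case (Cons a U)
  from Cons.prems(1) show ?case
  proof (cases rule: wall_cases)
    case (1 A)
    then show ?thesis using Cons by (simp add: cat_simps)
  next
    case (2 A)
    then show ?thesis using Cons
      by (auto intro!: collect_cong Cons.IH dest: coshift_eltD(3) simp: tests_def)
  qed
qed (simp add: assms)

lemma along_map_comp:
  "\<lbrakk>U \<in> walls; X \<in> Obj M\<rbrakk> \<Longrightarrow>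
    along_map U \<theta>' X (along_map U \<theta> X x) = along_map U (\<lambda>X x. \<theta>' X (\<theta> X x)) X x"
proof (induction U arbitrary: X x)
  case (Cons a U)
  from Cons.prems(1) show ?case
  proof (cases rule: wall_cases)
    case (1 A)
    then show ?thesis using Cons by (simp add: cat_simps)
  next
    case (2 A)
    then show ?thesis using Cons
      by (auto intro!: collect_cong Cons.IH simp: tests_def)
  qed
qed simp

text \<open>At a bullet the element is rebuilt from its values on tests, so extensionality of
  families is what gives the identity law.\<close>

lemma along_map_id:
  "\<lbrakk>U \<in> walls; X \<in> Obj M; x \<in> Elts (along U P) X\<rbrakk> \<Longrightarrow> along_map U (\<lambda>X x. x) X x = x"
proof (induction U arbitrary: X x)
  case (Cons a U)
  from Cons.prems(1) show ?case
  proof (cases rule: wall_cases)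
    case (1 A)
    then show ?thesis using Cons by (simp add: cat_simps)
  next
    case (2 A)
    then show ?thesis using Cons coshift_eltD(2)[of x A "along U P" X]
      by (auto intro!: collect_eqI Cons.IH dest: coshift_eltD(3) simp: tests_def)
  qed
qed simp

section \<open>Interpretation of cells and its naturality\<close>

text \<open>For \<open>HComp\<close>, \<open>s\<close> acts with the top of \<open>t\<close> kept as
  part of the object, and \<open>t\<close> then acts over \<open>P\<close> shifted by the bottom of
  \<open>s\<close>. For \<open>VComp\<close>, \<open>s\<close> acts over \<open>P\<close> with the
  left wall of \<open>t\<close> already applied, and \<open>t\<close> then acts underneath the right
  wall of \<open>s\<close>.\<close>

primrec interp :: "('o, 'a) cell_term \<Rightarrow> ('o, 'a, 'b) copresheaf
    \<Rightarrow> 'o \<Rightarrow> ('o, 'a, 'b) element \<Rightarrow> ('o, 'a, 'b) element" where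
  "interp (SCirc A) P = (\<lambda>X x. x)"
| "interp (RCirc A) P = (\<lambda>X x. x)"
| "interp (SBullet A) P = (\<lambda>X x. feed x (X, Ident M (tensor_obj M A X)))"
| "interp (RBullet A) P = (\<lambda>X x. collect (tests A X) (\<lambda>(Y, h). act P h x))"
| "interp (Lift f) P = (\<lambda>X x. act P (tensor_arr M f (Ident M X)) x)"
| "interp (HIdent A) P = (\<lambda>X x. x)"
| "interp (VIdent U) P = (\<lambda>X x. x)"
| "interp (HComp s t) P = (\<lambda>X x.
    interp t (shift (tm_bot M s) P) X (interp s P (tensor_obj M (tm_top M t) X) x))"
| "interp (VComp s t) P = (\<lambda>X x.
    along_map (tm_right s) (interp t P) X (interp s (along (tm_left t) P) X x))"

lemma wf_walls:
  assumes "wf_term M s"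
  shows "tm_left s \<in> walls" "tm_right s \<in> walls" "tm_top M s \<in> Obj M" "tm_bot M s \<in> Obj M"
  using wf_term_boundaries[OF assms] by (simp_all add: exchange_monoid_def)

lemma natural_ident: "natural P P (\<lambda>X x. x)"
  by (simp add: natural_def)

lemma natural_comp:
  "\<lbrakk>natural P Q \<theta>; natural Q R \<theta>'\<rbrakk> \<Longrightarrow> natural P R (\<lambda>X x. \<theta>' X (\<theta> X x))"
  by (simp add: natural_def dom_obj)

text \<open>The typing of the interpretation together with naturality in the object. Naturality in
  the copresheaf needs a separate induction, since it compares two copresheaves.\<close>

lemma natural_interp:
  "\<lbrakk>wf_term M s; is_copresheaf P\<rbrakk> \<Longrightarrow>
    natural (shift (tm_top M s) (along (tm_left s) P)) (along (tm_right s) (shift (tm_bot M s) P))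
      (interp s P)"
proof (induction s arbitrary: P)
  case (SCirc A)
  then show ?case by (simp add: shift_unit natural_ident)
next
  case (RCirc A)
  then show ?case by (simp add: shift_unit is_copresheaf_shift natural_ident)
next
  case (SBullet A)
  then have A: "A \<in> Obj M" and P: "is_copresheaf P" by auto
  have "natural (shift A (coshift A P)) P (interp (SBullet A) P)"
    unfolding natural_def
  proof (intro conjI ballI)
    fix X x assume "X \<in> Obj M" "x \<in> Elts (shift A (coshift A P)) X"
    then show "interp (SBullet A) P X x \<in> Elts P X"
      using coshift_eltD(3) tests_ident[OF A] by fastforce
  next
    fix m x assume m: "m \<in> Arr M" and x: "x \<in> Elts (shift A (coshift A P)) (Dom M m)"
    \<comment> \<open>Both routes end at the test \<open>whisker A m\<close>: one by naturality of
      the family \<open>x\<close> from the universal test, the other because acting precomposes the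
      universal test with \<open>whisker A m\<close>.\<close>
    have "feed x (Cod M m, Ident M (tensor_obj M A (Dom M m)) \<Zsemi> whisker A m) =
        act P m (feed x (Dom M m, Ident M (tensor_obj M A (Dom M m))))"
      using x m A by (intro coshift_eltD(4)[OF _ tests_ident]) (auto simp: cat_simps)
    moreover have "Ident M (tensor_obj M A (Dom M m)) \<Zsemi> whisker A m = whisker A m"
      "whisker A m \<Zsemi> Ident M (tensor_obj M A (Cod M m)) = whisker A m"
      using m A comp_ident_left[of "whisker A m"] comp_ident_right[of "whisker A m"]
      by (simp_all add: cat_simps whisker_simps)
    ultimately show "interp (SBullet A) P (Cod M m) (act (shift A (coshift A P)) m x) =
        act P m (interp (SBullet A) P (Dom M m) x)"
      using m A tests_ident[of A "Cod M m"] by (simp add: coshift_act whisker_simps cod_obj)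
  qed
  then show ?case using P by (simp add: shift_unit)
next
  case (RBullet A)
  then have A: "A \<in> Obj M" and P: "is_copresheaf P" by auto
  have "natural P (coshift A (shift A P)) (interp (RBullet A) P)"
    unfolding natural_def
  proof (intro conjI ballI)
    fix X x assume X: "X \<in> Obj M" and x: "x \<in> Elts P X"
    show "interp (RBullet A) P X x \<in> Elts (coshift A (shift A P)) X"
      unfolding interp.simps using X x A copresheafD(3,5)[OF P]
      by (intro coshift_collectI) (auto simp: tests_def whisker_simps)
  next
    fix m x assume m: "m \<in> Arr M" and x: "x \<in> Elts P (Dom M m)"
    have "act P (m \<Zsemi> h) x = act P h (act P m x)" if "(Y, h) \<in> tests A (Cod M m)" for Y h
      using that m x copresheafD(5)[OF P m] by (auto simp: tests_def)
    then show "interp (RBullet A) P (Cod M m) (act P m x) =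
        act (coshift A (shift A P)) m (interp (RBullet A) P (Dom M m) x)"
      using m tests_precomp[OF A _ m] by (auto simp: coshift_act intro!: collect_cong)
  qed
  then show ?case using P by (simp add: shift_unit)
next
  case (Lift f)
  then have f: "f \<in> Arr M" and P: "is_copresheaf P" by auto
  have "act P (tensor_arr M f (Ident M (Cod M m))) (act P (whisker (Dom M f) m) x) =
      act P (whisker (Cod M f) m) (act P (tensor_arr M f (Ident M (Dom M m))) x)"
    if m: "m \<in> Arr M" and x: "x \<in> Elts P (tensor_obj M (Dom M f) (Dom M m))" for m x
  proof -
    have "act P (tensor_arr M f (Ident M (Cod M m))) (act P (whisker (Dom M f) m) x) =
        act P (whisker (Dom M f) m \<Zsemi> tensor_arr M f (Ident M (Cod M m))) x"
      using f m x by (intro copresheafD(5)[OF P, symmetric]) (auto simp: cat_simps whisker_simps)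
    also have "\<dots> = act P (tensor_arr M f (Ident M (Dom M m)) \<Zsemi> whisker (Cod M f) m) x"
      by (simp add: tensor_slide f m)
    also have "\<dots> = act P (whisker (Cod M f) m) (act P (tensor_arr M f (Ident M (Dom M m))) x)"
      using f m x by (intro copresheafD(5)[OF P]) (auto simp: cat_simps whisker_simps)
    finally show ?thesis .
  qed
  then show ?case
    using f by (auto simp: natural_def cat_simps intro!: copresheafD(3)[OF P])
next
  case (HIdent A)
  then show ?case by (simp add: natural_ident)
next
  case (VIdent U)
  then show ?case
    by (simp add: exchange_monoid_def shift_unit is_copresheaf_along natural_ident)
next
  case (HComp s t)
  then have wf: "wf_term M s" "wf_term M t" and st: "tm_right s = tm_left t" by auto
  note w = wf_walls[OF wf(1)] wf_walls[OF wf(2)]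
  have "natural (shift (tm_top M t) (shift (tm_top M s) (along (tm_left s) P)))
      (shift (tm_top M t) (along (tm_right s) (shift (tm_bot M s) P)))
      (\<lambda>X. interp s P (tensor_obj M (tm_top M t) X))"
    by (intro natural_shift HComp w wf)
  moreover have "natural (shift (tm_top M t) (along (tm_left t) (shift (tm_bot M s) P)))
      (along (tm_right t) (shift (tm_bot M t) (shift (tm_bot M s) P)))
      (interp t (shift (tm_bot M s) P))"
    by (intro HComp is_copresheaf_shift w wf)
  ultimately have "natural (shift (tm_top M t) (shift (tm_top M s) (along (tm_left s) P)))
      (along (tm_right t) (shift (tm_bot M t) (shift (tm_bot M s) P))) (interp (HComp s t) P)"
    unfolding st interp.simps by (rule natural_comp)
  then show ?case using w by (simp add: shift_shift)
next
  case (VComp s t)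
  then have wf: "wf_term M s" "wf_term M t" and st: "tm_bot M s = tm_top M t" by auto
  note w = wf_walls[OF wf(1)] wf_walls[OF wf(2)]
  have "natural (shift (tm_top M s) (along (tm_left s) (along (tm_left t) P)))
      (along (tm_right s) (shift (tm_bot M s) (along (tm_left t) P)))
      (interp s (along (tm_left t) P))"
    by (intro VComp is_copresheaf_along w wf)
  moreover have "natural (along (tm_right s) (shift (tm_top M t) (along (tm_left t) P)))
      (along (tm_right s) (along (tm_right t) (shift (tm_bot M t) P)))
      (along_map (tm_right s) (interp t P))"
    by (intro VComp natural_along_map w wf)
  ultimately have "natural (shift (tm_top M s) (along (tm_left s) (along (tm_left t) P)))
      (along (tm_right s) (along (tm_right t) (shift (tm_bot M t) P))) (interp (VComp s t) P)"
    unfolding st interp.simps by (rule natural_comp)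
  then show ?case by (simp add: along_append)
qed

lemma interp_closed:
  assumes "wf_term M s" "is_copresheaf P" "X \<in> Obj M"
    "x \<in> Elts (along (tm_left s) P) (tensor_obj M (tm_top M s) X)"
  shows "interp s P X x \<in> Elts (along (tm_right s) (shift (tm_bot M s) P)) X"
  using naturalD(1)[OF natural_interp[OF assms(1,2)] assms(3)] assms(3,4) by simp

text \<open>Naturality in the copresheaf, along any \<theta>. Taking for \<theta> the interpretation
  of another cell yields the interchange law; taking a map out of a representable yields
  fullness.\<close>

lemma interp_along_map:
  "\<lbrakk>wf_term M s; is_copresheaf P; is_copresheaf Q; natural P Q \<theta>; X \<in> Obj M;
    x \<in> Elts (along (tm_left s) P) (tensor_obj M (tm_top M s) X)\<rbrakk> \<Longrightarrow>
    interp s Q X (along_map (tm_left s) \<theta> (tensor_obj M (tm_top M s) X) x) =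
    along_map (tm_right s) (\<lambda>X. \<theta> (tensor_obj M (tm_bot M s) X)) X (interp s P X x)"
proof (induction s arbitrary: P Q \<theta> X x)
  case (SBullet A)
  then show ?case using tests_ident[of A X] by (simp add: cat_simps)
next
  case (RBullet A)
  then show ?case
    by (auto simp: tests_def cat_simps intro!: collect_cong naturalD(2)[symmetric])
next
  case (Lift f)
  then show ?case
    using naturalD(2)[OF Lift(4), of "tensor_arr M f (Ident M X)"] by (simp add: cat_simps)
next
  case (VIdent U)
  then show ?case
    by (auto simp: cat_simps exchange_monoid_def intro!: along_map_cong)
next
  case (HComp s t)
  then have wf: "wf_term M s" "wf_term M t" and st: "tm_right s = tm_left t" by auto
  note w = wf_walls[OF wf(1)] wf_walls[OF wf(2)]
  let ?T = "tensor_obj M (tm_top M t) X" and ?B = "tm_bot M s"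
  have T: "?T \<in> Obj M" using w HComp.prems by (simp add: cat_simps)
  have x: "x \<in> Elts (along (tm_left s) P) (tensor_obj M (tm_top M s) ?T)"
    using HComp.prems w by (simp add: cat_simps)
  have sx: "interp s P ?T x \<in> Elts (along (tm_left t) (shift ?B P)) ?T"
    using interp_closed[OF wf(1) HComp.prems(2) T x] st by simp
  have "interp (HComp s t) Q X (along_map (tm_left s) \<theta> (tensor_obj M (tm_top M s) ?T) x) =
      interp t (shift ?B Q) X (along_map (tm_left t) (\<lambda>X. \<theta> (tensor_obj M ?B X)) ?T (interp s P ?T x))"
    using HComp.IH(1)[OF wf(1) HComp.prems(2-4) T x] st by simp
  also have "\<dots> = along_map (tm_right t) (\<lambda>X. \<theta> (tensor_obj M ?B (tensor_obj M (tm_bot M t) X))) X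
      (interp t (shift ?B P) X (interp s P ?T x))"
    using HComp.prems w sx
    by (intro HComp.IH(2)) (auto intro: wf is_copresheaf_shift natural_shift)
  \<comment> \<open>Tensors reassociate only on objects, so the two whiskered transformations need
    not be equal as functions and are compared on actual elements.\<close>
  also have "\<dots> = along_map (tm_right t) (\<lambda>X. \<theta> (tensor_obj M (tensor_obj M ?B (tm_bot M t)) X)) X
      (interp t (shift ?B P) X (interp s P ?T x))"
    using HComp.prems w sx
    by (intro along_map_cong[where P = "shift (tm_bot M t) (shift ?B P)"] interp_closed)
      (auto simp: cat_simps intro: wf is_copresheaf_shift)
  finally show ?case using w HComp.prems by (simp add: cat_simps)
next
  case (VComp s t)
  then have wf: "wf_term M s" "wf_term M t" and st: "tm_bot M s = tm_top M t" by auto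
  note w = wf_walls[OF wf(1)] wf_walls[OF wf(2)]
  let ?U = "tm_left t" and ?V = "tm_right s"
  have x: "x \<in> Elts (along (tm_left s) (along ?U P)) (tensor_obj M (tm_top M s) X)"
    using VComp.prems by (simp add: along_append)
  have U: "is_copresheaf (along ?U P)" "is_copresheaf (along ?U Q)"
    using VComp.prems w by (auto intro: is_copresheaf_along)
  let ?y = "interp s (along ?U P) X x"
  have y: "?y \<in> Elts (along ?V (shift (tm_top M t) (along ?U P))) X"
    using interp_closed[OF wf(1) U(1) _ x] VComp.prems st by simp
  \<comment> \<open>The hypothesis for \<open>s\<close> is used with
    \<open>along_map ?U \<theta>\<close> in place of \<theta>; the hypothesis for \<open>t\<close>
    is then applied pointwise underneath the wall \<open>?V\<close>.\<close>
  have "interp (VComp s t) Q X (along_map (tm_left (VComp s t)) \<theta> (tensor_obj M (tm_top M s) X) x) =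
     along_map ?V (interp t Q) X
       (along_map ?V (\<lambda>X. along_map ?U \<theta> (tensor_obj M (tm_top M t) X)) X ?y)"
    using VComp.IH(1)[OF wf(1) U natural_along_map[OF VComp.prems(4)] _ x] w VComp.prems st
    by (simp add: along_map_append)
  also have "\<dots> = along_map ?V
      (\<lambda>X z. interp t Q X (along_map ?U \<theta> (tensor_obj M (tm_top M t) X) z)) X ?y"
    using w VComp.prems by (intro along_map_comp)
  also have "\<dots> = along_map ?V
      (\<lambda>X z. along_map (tm_right t) (\<lambda>X. \<theta> (tensor_obj M (tm_bot M t) X)) X (interp t P X z)) X ?y"
    using y w VComp.prems by (intro along_map_cong VComp.IH(2)) (auto intro: wf)
  also have "\<dots> = along_map ?V (along_map (tm_right t) (\<lambda>X. \<theta> (tensor_obj M (tm_bot M t) X))) X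
      (along_map ?V (interp t P) X ?y)"
    using w VComp.prems by (intro along_map_comp[symmetric])
  finally show ?case by (simp add: along_map_append)
qed (auto simp: cat_simps)

section \<open>Soundness of the interpretation\<close>

text \<open>Induction on the derivation. Associativity and units hold because the action is strict,
  the bullet yanking equations are the triangle identities, and interchange is naturality in the
  copresheaf.\<close>

lemma interp_sound:
  assumes "cell_eq M s t"
  shows "\<lbrakk>is_copresheaf P; X \<in> Obj M; x \<in> Elts (along (tm_left s) P) (tensor_obj M (tm_top M s) X)\<rbrakk>
    \<Longrightarrow> interp s P X x = interp t P X x"
  using assms
proof (induction arbitrary: P X x)
  case (eq_sym s t)
  then show ?case using cell_eq_boundaries by metis
next
  case (eq_trans s t u)
  then show ?case using cell_eq_boundaries by metis
next
  case (eq_hcomp s s' t t')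
  then have wf: "wf_term M s" "wf_term M t" and st: "tm_right s = tm_left t" by auto
  note w = wf_walls[OF wf(1)] wf_walls[OF wf(2)]
  have b: "tm_bot M s' = tm_bot M s" "tm_top M t' = tm_top M t"
    using cell_eq_boundaries eq_hcomp.hyps by metis+
  let ?Y = "tensor_obj M (tm_top M t) X"
  have Y: "?Y \<in> Obj M" and x: "x \<in> Elts (along (tm_left s) P) (tensor_obj M (tm_top M s) ?Y)"
    using eq_hcomp.prems w by (simp_all add: cat_simps)
  have "interp s P ?Y x \<in> Elts (along (tm_left t) (shift (tm_bot M s) P)) ?Y"
    using interp_closed[OF wf(1) _ Y x] eq_hcomp.prems(1) st by simp
  then have "interp t (shift (tm_bot M s) P) X (interp s P ?Y x) =
      interp t' (shift (tm_bot M s) P) X (interp s P ?Y x)"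
    using eq_hcomp.prems w by (intro eq_hcomp.IH(2)) (auto intro: is_copresheaf_shift)
  then show ?case using eq_hcomp.IH(1)[OF eq_hcomp.prems(1) Y x] b by simp
next
  case (eq_vcomp s s' t t')
  then have wf: "wf_term M s" "wf_term M t" and st: "tm_bot M s = tm_top M t" by auto
  note w = wf_walls[OF wf(1)] wf_walls[OF wf(2)]
  have b: "tm_right s' = tm_right s" "tm_left t' = tm_left t"
    using cell_eq_boundaries eq_vcomp.hyps by metis+
  let ?P = "along (tm_left t) P"
  have P: "is_copresheaf ?P" using eq_vcomp.prems w by (auto intro: is_copresheaf_along)
  have x: "x \<in> Elts (along (tm_left s) ?P) (tensor_obj M (tm_top M s) X)"
    using eq_vcomp.prems by (simp add: along_append)
  have "interp s ?P X x \<in> Elts (along (tm_right s) (shift (tm_top M t) ?P)) X"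
    using interp_closed[OF wf(1) P eq_vcomp.prems(2) x] st by simp
  then have "along_map (tm_right s) (interp t P) X (interp s ?P X x) =
      along_map (tm_right s) (interp t' P) X (interp s ?P X x)"
    using eq_vcomp.prems w by (intro along_map_cong eq_vcomp.IH(2)) auto
  then show ?case using eq_vcomp.IH(1)[OF P eq_vcomp.prems(2) x] b by simp
next
  case (eq_hcomp_assoc s t u)
  then show ?case
    using wf_walls[of s] wf_walls[of t] wf_walls[of u] by (simp add: shift_shift cat_simps)
next
  case (eq_vcomp_assoc s t u)
  then show ?case
    using wf_walls[of s]
    by (simp add: along_map_append along_append along_map_comp)
next
  case (eq_hcomp_ident_left s)
  then show ?case by (simp add: shift_unit)
next
  case (eq_hcomp_ident_right s)
  then show ?case by (simp add: cat_simps)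
next
  case (eq_vcomp_ident_right s)
  then show ?case
    using wf_walls[of s] interp_closed[of s P X x] by (simp add: along_map_id along_append)
next
  case (eq_vident_mult U V)
  then show ?case
    by (simp add: exchange_monoid_def along_map_id along_append cat_simps)
next
  case (eq_interchange s t u v)
  note w = wf_walls[OF eq_interchange(1)] wf_walls[OF eq_interchange(2)]
    wf_walls[OF eq_interchange(3)] wf_walls[OF eq_interchange(4)]
  let ?P = "along (tm_left t) P" and ?C = "tm_bot M t" and ?Y = "tensor_obj M (tm_top M u) X"
  have P: "is_copresheaf ?P" using w eq_interchange by (auto intro: is_copresheaf_along)
  have Y: "?Y \<in> Obj M" using w eq_interchange by (simp add: cat_simps)
  have x: "x \<in> Elts (along (tm_left s) ?P) (tensor_obj M (tm_top M s) ?Y)"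
    using eq_interchange w by (simp add: along_append cat_simps)
  let ?y = "interp s ?P ?Y x"
  have y: "?y \<in> Elts (along (tm_left u) (shift (tm_top M t) ?P)) ?Y"
    using interp_closed[OF eq_interchange(1) P Y x] eq_interchange by simp
  have nt: "natural (shift (tm_top M t) ?P) (along (tm_left v) (shift ?C P)) (interp t P)"
    using natural_interp[of t P] eq_interchange by simp
  \<comment> \<open>The upper right cell \<open>u\<close> moves past the lower left cell
    \<open>t\<close>: naturality of \<open>u\<close> in the copresheaf along the transformation
    \<open>interp t P\<close>.\<close>
  have "interp u (along (tm_left v) (shift ?C P)) X (along_map (tm_left u) (interp t P) ?Y ?y) =
      along_map (tm_right u) (\<lambda>X. interp t P (tensor_obj M (tm_bot M u) X)) X
        (interp u (shift (tm_top M t) ?P) X ?y)"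
    using eq_interchange w y
    by (intro interp_along_map[OF _ _ _ nt]) (auto intro: is_copresheaf_shift is_copresheaf_along)
  then show ?case
    using eq_interchange w by (simp add: along_map_comp)
next
  case (yank_circ_h A)
  then show ?case by simp
next
  case (yank_circ_v A)
  then show ?case by (simp add: cat_simps)
next
  case (yank_bullet_h A)
  then show ?case
    using tests_ident[of A X] copresheafD(4)[of P "tensor_obj M A X" x] by (simp add: cat_simps)
next
  case (yank_bullet_v A)
  \<comment> \<open>Unit followed by counit evaluates \<open>x\<close> at \<open>h\<close> followed
    by an identity, hence at \<open>h\<close>; extensionality then returns \<open>x\<close>.\<close>
  have "(Y, h \<Zsemi> Ident M (tensor_obj M A Y)) = (Y, h)" if "(Y, h) \<in> tests A X" for Y h
    using that comp_ident_right[of h] by (auto simp: tests_def)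
  moreover have "tensor_obj M A Y \<in> Obj M \<and> (Y, Ident M (tensor_obj M A Y)) \<in> tests A (tensor_obj M A Y) \<and>
      h \<in> Arr M \<and> Cod M h = tensor_obj M A Y"
    if "(Y, h) \<in> tests A X" for Y h
    using that tests_ident[of A Y] yank_bullet_v by (auto simp: tests_def cat_simps)
  ultimately show ?case
    using yank_bullet_v coshift_eltD(2)[of x A P X]
    by (auto simp: cat_simps coshift_act intro!: collect_eqI)
next
  case (lift_comp f g)
  have "tensor_arr M (f \<Zsemi> g) (Ident M X) = tensor_arr M f (Ident M X) \<Zsemi> tensor_arr M g (Ident M X)"
    using lift_comp tensor_comp[of f g "Ident M X" "Ident M X"] comp_ident_left[of "Ident M X"]
    by (simp add: cat_simps)
  then show ?case
    using lift_comp copresheafD(5)[of P "tensor_arr M f (Ident M X)" "tensor_arr M g (Ident M X)"]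
    by (simp add: cat_simps)
next
  case (lift_ident A)
  then show ?case by (simp add: cat_simps copresheafD(4))
next
  case (lift_tensor f g)
  let ?g = "tensor_arr M g (Ident M X)"
  let ?f = "tensor_arr M f (Ident M (Dom M ?g))"
  \<comment> \<open>The factorization follows the clause for \<open>HComp\<close>: \<open>f\<close>
    acts first, then \<open>g\<close> whiskered by the bottom of \<open>f\<close>.\<close>
  have "tensor_arr M (tensor_arr M f g) (Ident M X) = ?f \<Zsemi> whisker (Cod M f) ?g"
    using lift_tensor tensor_arr_assoc[of f g "Ident M X"] comp_ident_left[of ?g]
      tensor_comp[of f "Ident M (Cod M f)" "Ident M (Dom M ?g)" ?g]
    by (simp add: whisker_def cat_simps)
  then show ?case
    using lift_tensor copresheafD(5)[of P ?f "whisker (Cod M f) ?g" x]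
    by (simp add: cat_simps whisker_simps)
qed (simp_all add: cat_simps)

section \<open>Faithfulness\<close>

text \<open>The covariant representable at \<open>A\<close>. Morphisms are stored as constant
  functions to fit the type of elements.\<close>

definition representable :: "'o \<Rightarrow> ('o, 'a, 'a) copresheaf" where
  "representable A =
    \<lparr>Elts = (\<lambda>X. {\<lambda>l. f |f. f \<in> Arr M \<and> Dom M f = A \<and> Cod M f = X}),
     act = (\<lambda>m. if m \<in> Arr M then (\<lambda>x l. x l \<Zsemi> m) else undefined)\<rparr>"

lemma is_copresheaf_representable: "is_copresheaf (representable A)"
  unfolding is_copresheaf_def representable_def
  by (auto simp: cat_simps comp_assoc)

text \<open>Evaluation at the universal element, as in the Yoneda lemma; together with soundness it
  recovers \<open>f\<close> from the class of \<open>Lift f\<close>.\<close>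

lemma interp_lift_representable:
  assumes "f \<in> Arr M"
  shows "interp (Lift f) (representable (Dom M f)) (unit_obj M) (\<lambda>l. Ident M (Dom M f)) = (\<lambda>l. f)"
  using assms by (simp add: representable_def cat_simps)

lemma Lift_faithful:
  assumes "f \<in> Arr M" "g \<in> Arr M" "cell_eq M (Lift f) (Lift g)"
  shows "f = g"
proof -
  have "Dom M f = Dom M g" using cell_eq_boundaries[OF assms(3)] by simp
  moreover have "interp (Lift f) (representable (Dom M f)) (unit_obj M) (\<lambda>l. Ident M (Dom M f)) =
      interp (Lift g) (representable (Dom M f)) (unit_obj M) (\<lambda>l. Ident M (Dom M f))"
    using assms
    by (intro interp_sound is_copresheaf_representable) (auto simp: representable_def cat_simps)
  ultimately show ?thesis
    using interp_lift_representable assms(1,2) by metis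
qed

section \<open>Closings, observers and probes\<close>

declare eq_trans [trans]

text \<open>A closing \<open>e\<close> absorbs the vertical edge \<open>U\<close> from the right; \<open>probe\<close> restricts a function of
  closings to those assembled from corners and morphisms, which is exactly what an element of
  \<open>along U P\<close> records.\<close>

definition closings :: "'o exchange \<Rightarrow> 'o \<Rightarrow> ('o, 'a) cell_term set" where
  "closings U X = {e. wf_term M e \<and> tm_left e = U \<and> tm_right e = [] \<and> tm_top M e = X}"

primrec probe :: "'o exchange \<Rightarrow> 'o \<Rightarrow> (('o, 'a) cell_term \<Rightarrow> ('o, 'a, 'b) element)
    \<Rightarrow> ('o, 'a, 'b) element" where
  "probe [] X q = q (HIdent X)"
| "probe (a # U) X q = (case snd a of
      Circ \<Rightarrow> probe U (tensor_obj M (fst a) X)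
        (\<lambda>e. q (VComp (HComp (RCirc (fst a)) (HIdent X)) e))
    | Bullet \<Rightarrow> collect (tests (fst a) X) (\<lambda>(Y, h). probe U Y
        (\<lambda>e. q (VComp (VComp (Lift h) (HComp (SBullet (fst a)) (HIdent Y))) e))))"

text \<open>The conditions under which probing \<open>q\<close> gives an element of
  \<open>along U P\<close>. The typical \<open>q\<close> sends a closing to the class of a composite
  built around it.\<close>

definition observer :: "('o, 'a, 'b) copresheaf \<Rightarrow> 'o exchange \<Rightarrow> 'o
    \<Rightarrow> (('o, 'a) cell_term \<Rightarrow> ('o, 'a, 'b) element) \<Rightarrow> bool" where
  "observer P U X q \<longleftrightarrow> (\<forall>e \<in> closings U X. q e \<in> Elts P (tm_bot M e) \<and>
    (\<forall>e'. cell_eq M e e' \<longrightarrow> q e = q e') \<and>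
    (\<forall>k \<in> Arr M. Dom M k = tm_bot M e \<longrightarrow> q (VComp e (Lift k)) = act P k (q e)))"

lemma observerD:
  assumes "observer P U X q" "e \<in> closings U X"
  shows "q e \<in> Elts P (tm_bot M e)" "cell_eq M e e' \<Longrightarrow> q e = q e'"
    "\<lbrakk>k \<in> Arr M; Dom M k = tm_bot M e\<rbrakk> \<Longrightarrow> q (VComp e (Lift k)) = act P k (q e)"
  using assms by (auto simp: observer_def)

lemma closings_vcomp:
  "\<lbrakk>d \<in> closings U X; e \<in> closings V (tm_bot M d)\<rbrakk> \<Longrightarrow> VComp d e \<in> closings (U @ V) X"
  by (simp add: closings_def)

lemma closings_Lift: "k \<in> Arr M \<Longrightarrow> Lift k \<in> closings [] (Dom M k)"
  by (simp add: closings_def)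

lemma closings_bot: "e \<in> closings U X \<Longrightarrow> tm_bot M e \<in> Obj M"
  by (simp add: closings_def wf_walls)

lemma closings_RCirc:
  assumes "A \<in> Obj M" "X \<in> Obj M"
  shows "HComp (RCirc A) (HIdent X) \<in> closings [(A, Circ)] X"
  using assms by (simp add: closings_def cat_simps)

lemma closings_SBullet:
  assumes "(Y, h) \<in> tests A X" "A \<in> Obj M"
  shows "VComp (Lift h) (HComp (SBullet A) (HIdent Y)) \<in> closings [(A, Bullet)] X"
  using assms by (auto simp: closings_def tests_def cat_simps)

lemma HIdent_closings: "X \<in> Obj M \<Longrightarrow> HIdent X \<in> closings [] X"
  by (simp add: closings_def)

text \<open>Once \<open>d\<close> has absorbed the upper part \<open>U\<close> of the wall, what
  remains is observed below \<open>d\<close>; naturality survives by reassociating the vertical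
  composite.\<close>

lemma observer_vcomp:
  assumes d: "d \<in> closings U X" and q: "observer P (U @ V) X q"
  shows "observer P V (tm_bot M d) (\<lambda>e. q (VComp d e))"
  unfolding observer_def
proof (intro ballI conjI allI impI)
  fix e assume e: "e \<in> closings V (tm_bot M d)"
  note de = closings_vcomp[OF d e]
  show "q (VComp d e) \<in> Elts P (tm_bot M e)" using observerD(1)[OF q de] by simp
  show "q (VComp d e) = q (VComp d e')" if "cell_eq M e e'" for e'
    using that d e by (intro observerD(2)[OF q de] eq_vcomp) (auto simp: closings_def eq_refl)
  show "q (VComp d (VComp e (Lift k))) = act P k (q (VComp d e))"
    if "k \<in> Arr M" "Dom M k = tm_bot M e" for k
  proof -
    have "wf_term M (VComp (VComp d e) (Lift k))"
      using that d e by (simp add: closings_def)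
    moreover from this have "VComp (VComp d e) (Lift k) \<in> closings (U @ V) X"
      using d e by (simp add: closings_def)
    ultimately have "q (VComp (VComp d e) (Lift k)) = q (VComp d (VComp e (Lift k)))"
      by (intro observerD(2)[OF q] eq_vcomp_assoc)
    then show ?thesis using observerD(3)[OF q de] that by simp
  qed
qed

lemma probe_cong:
  "\<lbrakk>U \<in> walls; X \<in> Obj M; \<And>e. e \<in> closings U X \<Longrightarrow> q e = q' e\<rbrakk> \<Longrightarrow> probe U X q = probe U X q'"
proof (induction U arbitrary: X q q')
  case (Cons a U)
  from Cons.prems(1) show ?case
  proof (cases rule: wall_cases)
    case (1 A)
    have "VComp (HComp (RCirc A) (HIdent X)) e \<in> closings (a # U) X"
      if "e \<in> closings U (tensor_obj M A X)" for e
      using that closings_vcomp[OF closings_RCirc[of A X], of e U] 1 Cons.prems by simp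
    then show ?thesis using 1 Cons.prems by (auto simp: cat_simps intro!: Cons.IH)
  next
    case (2 A)
    have "VComp (VComp (Lift h) (HComp (SBullet A) (HIdent Y))) e \<in> closings (a # U) X"
      if "(Y, h) \<in> tests A X" "e \<in> closings U Y" for Y h e
      using that closings_vcomp[OF closings_SBullet[of Y h A X], of e U] 2 Cons.prems
      by (simp add: cat_simps tests_def)
    then show ?thesis using 2 Cons.prems
      by (auto simp: tests_def intro!: collect_cong Cons.IH)
  qed
qed (simp add: HIdent_closings)

lemma along_map_probe:
  "along_map U \<theta> X (probe U X q) = probe U X (\<lambda>e. \<theta> (tm_bot M e) (q e))"
proof (induction U arbitrary: X q)
  case (Cons a U)
  then show ?case by (cases a; cases "snd a") (auto intro!: collect_cong)
qed simp

lemma closings_vcomp_assoc: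
  assumes "c \<in> closings U X" "d \<in> closings V (tm_bot M c)" "e \<in> closings W (tm_bot M d)"
  shows "cell_eq M (VComp (VComp c d) e) (VComp c (VComp d e))"
  using assms by (intro eq_vcomp_assoc) (simp add: closings_def)

lemma observer_assoc:
  assumes "observer P (U @ V @ W) X q"
    "c \<in> closings U X" "d \<in> closings V (tm_bot M c)" "e \<in> closings W (tm_bot M d)"
  shows "q (VComp (VComp c d) e) = q (VComp c (VComp d e))"
proof (rule observerD(2)[OF assms(1) _ closings_vcomp_assoc[OF assms(2-4)]])
  show "VComp (VComp c d) e \<in> closings (U @ V @ W) X"
    using assms(2-4) by (simp add: closings_def)
qed

text \<open>The two sides stack the same corners with different bracketing, which an observer cannot
  distinguish because it respects equality of cells.\<close>

lemma probe_append:
  "\<lbrakk>U \<in> walls; V \<in> walls; X \<in> Obj M; observer P (U @ V) X q\<rbrakk> \<Longrightarrow>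
    probe (U @ V) X q = probe U X (\<lambda>d. probe V (tm_bot M d) (\<lambda>e. q (VComp d e)))"
proof (induction U arbitrary: X q)
  case Nil
  \<comment> \<open>Probing the empty wall \<open>U\<close> leaves an identity above each closing of
    \<open>V\<close>.\<close>
  have "q e = q (VComp (HIdent X) e)" if "e \<in> closings V X" for e
    using that eq_sym[OF eq_vcomp_ident_left, of M e] Nil
    by (intro observerD(2)[of P V X q]) (auto simp: closings_def)
  then show ?case using Nil by (auto intro: probe_cong)
next
  case (Cons a U)
  have step: "probe (U @ V) (tm_bot M c) (\<lambda>e. q (VComp c e)) =
      probe U (tm_bot M c) (\<lambda>d. probe V (tm_bot M d) (\<lambda>e. q (VComp (VComp c d) e)))"
    if c: "c \<in> closings [a] X" for c
  proof -
    have q: "observer P ([a] @ U @ V) X q" using Cons.prems by simp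
    have "probe (U @ V) (tm_bot M c) (\<lambda>e. q (VComp c e)) =
        probe U (tm_bot M c) (\<lambda>d. probe V (tm_bot M d) (\<lambda>e. q (VComp c (VComp d e))))"
      using Cons.prems closings_bot[OF c] observer_vcomp[OF c q] by (intro Cons.IH) auto
    also have "\<dots> = probe U (tm_bot M c) (\<lambda>d. probe V (tm_bot M d) (\<lambda>e. q (VComp (VComp c d) e)))"
      using Cons.prems closings_bot[OF c]
      by (intro probe_cong observer_assoc[OF q c, symmetric]) (auto intro: closings_bot)
    finally show ?thesis .
  qed
  from Cons.prems(1) show ?case
  proof (cases rule: wall_cases)
    case (1 A)
    then show ?thesis using step[of "HComp (RCirc A) (HIdent X)"] closings_RCirc[of A X] Cons.prems
      by simp
  next
    case (2 A)
    then show ?thesis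
      using step[OF closings_SBullet[of _ _ A X, folded 2(1)]] Cons.prems
      by (auto intro!: collect_cong simp: tests_def tensor_obj_unit)
  qed
qed

section \<open>Sliding morphisms past cells\<close>

lemma cell_eq_Lift_whisker:
  assumes "A \<in> Obj M" "m \<in> Arr M"
  shows "cell_eq M (Lift (whisker A m)) (HComp (HIdent A) (Lift m))"
proof -
  have "cell_eq M (HComp (Lift (Ident M A)) (Lift m)) (Lift (whisker A m))"
    unfolding whisker_def using assms by (intro lift_tensor) (auto simp: cat_simps)
  moreover have "cell_eq M (HComp (Lift (Ident M A)) (Lift m)) (HComp (HIdent A) (Lift m))"
    using assms by (intro eq_hcomp lift_ident eq_refl) (auto simp: cat_simps)
  ultimately show ?thesis by (rule eq_trans[OF eq_sym])
qed

text \<open>Interchange with identity cells lets a morphism standing to the right of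
  \<open>s\<close> be drawn above it.\<close>

lemma whisker_above:
  assumes "wf_term M s" "tm_right s = []" "m \<in> Arr M"
  shows "cell_eq M (VComp (Lift (whisker (tm_top M s) m)) (HComp s (HIdent (Cod M m))))
    (HComp s (Lift m))"
proof -
  note w = wf_walls[OF assms(1)]
  have "cell_eq M (VComp (Lift (whisker (tm_top M s) m)) (HComp s (HIdent (Cod M m))))
      (VComp (HComp (HIdent (tm_top M s)) (Lift m)) (HComp s (HIdent (Cod M m))))"
    using assms w by (intro eq_vcomp eq_refl cell_eq_Lift_whisker) (auto simp: cat_simps whisker_simps)
  also have "cell_eq M \<dots>
      (HComp (VComp (HIdent (tm_top M s)) s) (VComp (Lift m) (HIdent (Cod M m))))"
    using assms w by (intro eq_sym[OF eq_interchange]) (auto simp: cat_simps)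
  also have "cell_eq M \<dots> (HComp s (Lift m))"
    using assms w eq_vcomp_ident_right[of M "Lift m"]
    by (intro eq_hcomp eq_vcomp_ident_left) (auto simp: cat_simps)
  finally show ?thesis .
qed

lemma whisker_below:
  assumes "wf_term M s" "tm_right s = []" "m \<in> Arr M"
  shows "cell_eq M (VComp (HComp s (HIdent (Dom M m))) (Lift (whisker (tm_bot M s) m)))
    (HComp s (Lift m))"
proof -
  note w = wf_walls[OF assms(1)]
  have "cell_eq M (VComp (HComp s (HIdent (Dom M m))) (Lift (whisker (tm_bot M s) m)))
      (VComp (HComp s (HIdent (Dom M m))) (HComp (HIdent (tm_bot M s)) (Lift m)))"
    using assms w by (intro eq_vcomp eq_refl cell_eq_Lift_whisker) (auto simp: cat_simps whisker_simps)
  also have "cell_eq M \<dots>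
      (HComp (VComp s (HIdent (tm_bot M s))) (VComp (HIdent (Dom M m)) (Lift m)))"
    using assms w by (intro eq_sym[OF eq_interchange]) (auto simp: cat_simps)
  also have "cell_eq M \<dots> (HComp s (Lift m))"
    using assms w eq_vcomp_ident_left[of M "Lift m"]
    by (intro eq_hcomp eq_vcomp_ident_right) (auto simp: cat_simps)
  finally show ?thesis .
qed

text \<open>Both sides equal \<open>HComp s (Lift m)\<close>. With \<open>s\<close> a corner this
  provides naturality of probes.\<close>

lemma whisker_slide:
  assumes "wf_term M s" "tm_right s = []" "m \<in> Arr M"
  shows "cell_eq M (VComp (Lift (whisker (tm_top M s) m)) (HComp s (HIdent (Cod M m))))
    (VComp (HComp s (HIdent (Dom M m))) (Lift (whisker (tm_bot M s) m)))"
  by (rule eq_trans[OF whisker_above[OF assms] eq_sym[OF whisker_below[OF assms]]])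

lemma observer_precomp_cong:
  assumes "observer P (U @ V) X q" "c \<in> closings U X" "cell_eq M c c'" "e \<in> closings V (tm_bot M c)"
  shows "q (VComp c e) = q (VComp c' e)"
  using assms closings_vcomp[OF assms(2,4)]
  by (intro observerD(2)[OF assms(1)] eq_vcomp eq_refl) (auto simp: closings_def)

section \<open>Probes are elements and are natural\<close>

text \<open>The two claims share one induction: a probe at a bullet is a natural family only because
  the probe of the shorter wall is compatible with the action.\<close>

lemma probe_closed_natural:
  "\<lbrakk>U \<in> walls; X \<in> Obj M; is_copresheaf P; observer P U X q\<rbrakk> \<Longrightarrow>
    probe U X q \<in> Elts (along U P) X \<and>
    (\<forall>m \<in> Arr M. Dom M m = X \<longrightarrow>
      act (along U P) m (probe U X q) = probe U (Cod M m) (\<lambda>e. q (VComp (Lift m) e)))"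
proof (induction U arbitrary: X q)
  case Nil
  have "act P m (q (HIdent X)) = q (VComp (Lift m) (HIdent (Cod M m)))"
    if m: "m \<in> Arr M" "Dom M m = X" for m
  proof -
    have "act P m (q (HIdent X)) = q (VComp (HIdent X) (Lift m))"
      using observerD(3)[OF Nil(4) HIdent_closings[OF Nil(2)] m(1)] m by simp
    also have "\<dots> = q (Lift m)"
      using m eq_vcomp_ident_left[of M "Lift m"]
      by (intro observerD(2)[OF Nil(4)]) (auto simp: closings_def cat_simps)
    also have "\<dots> = q (VComp (Lift m) (HIdent (Cod M m)))"
      using m eq_sym[OF eq_vcomp_ident_right[of M "Lift m"]] closings_Lift[of m]
      by (intro observerD(2)[OF Nil(4)]) auto
    finally show ?thesis .
  qed
  then show ?case using observerD(1)[OF Nil(4) HIdent_closings[OF Nil(2)]] by simp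
next
  case (Cons a U)
  \<comment> \<open>The induction hypothesis for the rest of the wall, as observed below a closing
    \<open>c\<close> of the first letter.\<close>
  have IH: "probe U (tm_bot M c) (\<lambda>e. q (VComp c e)) \<in> Elts (along U P) (tm_bot M c)"
    "\<lbrakk>m \<in> Arr M; Dom M m = tm_bot M c\<rbrakk> \<Longrightarrow>
      act (along U P) m (probe U (tm_bot M c) (\<lambda>e. q (VComp c e))) =
      probe U (Cod M m) (\<lambda>e. q (VComp (VComp c (Lift m)) e))"
    if c: "c \<in> closings [a] X" for c m
  proof -
    have q: "observer P ([a] @ U) X q" using Cons.prems by simp
    have U: "U \<in> walls" using Cons.prems by simp
    note ih = Cons.IH[OF U closings_bot[OF c] Cons.prems(3) observer_vcomp[OF c q]]
    show "probe U (tm_bot M c) (\<lambda>e. q (VComp c e)) \<in> Elts (along U P) (tm_bot M c)"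
      using ih by simp
    assume m: "m \<in> Arr M" "Dom M m = tm_bot M c"
    have "act (along U P) m (probe U (tm_bot M c) (\<lambda>e. q (VComp c e))) =
        probe U (Cod M m) (\<lambda>e. q (VComp c (VComp (Lift m) e)))"
      using ih m by simp
    also have "\<dots> = probe U (Cod M m) (\<lambda>e. q (VComp (VComp c (Lift m)) e))"
      using m U closings_Lift[of m] Cons.prems
      by (intro probe_cong observer_assoc[of P "[a]" "[]" U X, symmetric] c) (auto simp: cat_simps)
    finally show "act (along U P) m (probe U (tm_bot M c) (\<lambda>e. q (VComp c e))) =
      probe U (Cod M m) (\<lambda>e. q (VComp (VComp c (Lift m)) e))" .
  qed
  have q: "observer P ([a] @ U) X q" and U: "U \<in> walls" and X: "X \<in> Obj M"
    using Cons.prems by simp_all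
  from Cons.prems(1) show ?case
  proof (cases rule: wall_cases)
    case (1 A)
    let ?c = "\<lambda>X. HComp (RCirc A) (HIdent X)"
    have c: "?c X \<in> closings [a] X" using closings_RCirc[of A X] 1 X by simp
    have slide: "act (along U P) (whisker A m) (probe U (tensor_obj M A X) (\<lambda>e. q (VComp (?c X) e))) =
        probe U (tensor_obj M A (Cod M m)) (\<lambda>e. q (VComp (Lift m) (VComp (?c (Cod M m)) e)))"
      if m: "m \<in> Arr M" "Dom M m = X" for m
    proof -
      \<comment> \<open>A morphism below the circle corner, acting beside \<open>A\<close>, slides
        up to stand above the corner as \<open>m\<close>.\<close>
      have sl: "cell_eq M (VComp (?c X) (Lift (whisker A m))) (VComp (Lift m) (?c (Cod M m)))"
        using eq_sym[OF whisker_slide[of "RCirc A" m]] 1 m by (simp add: whisker_unit)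
      have cl: "VComp (?c X) (Lift (whisker A m)) \<in> closings [a] X"
        using closings_vcomp[OF c, of "Lift (whisker A m)" "[]"] closings_Lift[of "whisker A m"] 1 m
        by (simp add: whisker_simps)
      have "act (along U P) (whisker A m) (probe U (tensor_obj M A X) (\<lambda>e. q (VComp (?c X) e))) =
          probe U (tensor_obj M A (Cod M m)) (\<lambda>e. q (VComp (VComp (?c X) (Lift (whisker A m))) e))"
        using IH(2)[OF c, of "whisker A m"] m 1 by (simp add: whisker_simps)
      also have "\<dots> = probe U (tensor_obj M A (Cod M m)) (\<lambda>e. q (VComp (VComp (Lift m) (?c (Cod M m))) e))"
        using 1 m U X
        by (intro probe_cong observer_precomp_cong[OF q cl sl]) (auto simp: cat_simps whisker_simps)
      also have "\<dots> = probe U (tensor_obj M A (Cod M m)) (\<lambda>e. q (VComp (Lift m) (VComp (?c (Cod M m)) e)))"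
        using 1 m U X closings_Lift[of m] closings_RCirc[of A "Cod M m"] q
        by (intro probe_cong observer_assoc[of P "[]" "[a]" U X]) (auto simp: cat_simps)
      finally show ?thesis .
    qed
    then show ?thesis using IH(1)[OF c] 1 X by simp
  next
    case (2 A)
    let ?s = "\<lambda>Y. HComp (SBullet A) (HIdent Y)"
    have c: "VComp (Lift h) (?s Y) \<in> closings [a] X" if "(Y, h) \<in> tests A X" for Y h
      using closings_SBullet[of Y h A X] 2 that by simp
    have bot: "tm_bot M (VComp (Lift h) (?s Y)) = Y" if "(Y, h) \<in> tests A X" for Y h
      using that by (simp add: tests_def tensor_obj_unit)
    have "collect (tests A X) (\<lambda>(Y, h). probe U Y (\<lambda>e. q (VComp (VComp (Lift h) (?s Y)) e)))
        \<in> Elts (coshift A (along U P)) X"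
    proof (rule coshift_collectI[OF X _ _ 2(2)])
      fix Y h assume h: "(Y, h) \<in> tests A X"
      show "(case (Y, h) of (Y, h) \<Rightarrow> probe U Y (\<lambda>e. q (VComp (VComp (Lift h) (?s Y)) e)))
          \<in> Elts (along U P) Y"
        using IH(1)[OF c[OF h]] bot[OF h] by simp
      fix k assume k: "k \<in> Arr M" "Dom M k = Y"
        and hk: "(Cod M k, h \<Zsemi> whisker A k) \<in> tests A X"
      have h': "h \<in> Arr M" "Dom M h = X" "Cod M h = tensor_obj M A Y" using h by (auto simp: tests_def)
      \<comment> \<open>Extending the test by \<open>whisker A k\<close> attaches \<open>k\<close>
        below the bullet corner, by sliding; the hypothesis for the tail reads this as the action of
        \<open>k\<close>.\<close>
      have "cell_eq M (VComp (Lift (h \<Zsemi> whisker A k)) (?s (Cod M k)))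
          (VComp (VComp (Lift h) (Lift (whisker A k))) (?s (Cod M k)))"
        using h' k 2
        by (intro eq_vcomp eq_sym[OF lift_comp] eq_refl) (auto simp: whisker_simps cat_simps)
      also have "cell_eq M \<dots> (VComp (Lift h) (VComp (Lift (whisker A k)) (?s (Cod M k))))"
        using h' k 2 by (intro eq_vcomp_assoc) (auto simp: whisker_simps cat_simps)
      also have "cell_eq M \<dots> (VComp (Lift h) (VComp (?s Y) (Lift k)))"
        using h' k 2 whisker_slide[of "SBullet A" k]
        by (intro eq_vcomp[OF eq_refl]) (auto simp: whisker_simps cat_simps whisker_unit)
      also have "cell_eq M \<dots> (VComp (VComp (Lift h) (?s Y)) (Lift k))"
        using h' k 2 by (intro eq_sym[OF eq_vcomp_assoc]) (auto simp: whisker_simps cat_simps)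
      finally have sl: "cell_eq M (VComp (Lift (h \<Zsemi> whisker A k)) (?s (Cod M k)))
          (VComp (VComp (Lift h) (?s Y)) (Lift k))" .
      have "probe U (Cod M k) (\<lambda>e. q (VComp (VComp (Lift (h \<Zsemi> whisker A k)) (?s (Cod M k))) e)) =
          probe U (Cod M k) (\<lambda>e. q (VComp (VComp (VComp (Lift h) (?s Y)) (Lift k)) e))"
        using U k bot[OF hk]
        by (intro probe_cong observer_precomp_cong[OF q c[OF hk] sl]) (auto simp: cat_simps)
      also have "\<dots> = act (along U P) k (probe U Y (\<lambda>e. q (VComp (VComp (Lift h) (?s Y)) e)))"
        using IH(2)[OF c[OF h], of k] bot[OF h] k by simp
      finally show "(case (Cod M k, h \<Zsemi> whisker A k) of
            (Y, h) \<Rightarrow> probe U Y (\<lambda>e. q (VComp (VComp (Lift h) (?s Y)) e))) =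
          act (along U P) k (case (Y, h) of
            (Y, h) \<Rightarrow> probe U Y (\<lambda>e. q (VComp (VComp (Lift h) (?s Y)) e)))"
        by simp
    qed
    \<comment> \<open>Acting by \<open>m\<close> on a family precomposes its tests, which amounts to
      stacking \<open>Lift m\<close> on top of the closing.\<close>
    moreover have "probe U Y (\<lambda>e. q (VComp (VComp (Lift (m \<Zsemi> h)) (?s Y)) e)) =
        probe U Y (\<lambda>e. q (VComp (Lift m) (VComp (VComp (Lift h) (?s Y)) e)))"
      if m: "m \<in> Arr M" "Dom M m = X" and h: "(Y, h) \<in> tests A (Cod M m)" for m Y h
    proof -
      have h': "h \<in> Arr M" "Dom M h = Cod M m" "Cod M h = tensor_obj M A Y" "Y \<in> Obj M"
        using h by (auto simp: tests_def)
      have mh: "(Y, m \<Zsemi> h) \<in> tests A X" using tests_precomp[OF 2(2) h m(1)] m by simp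
      have "cell_eq M (VComp (Lift (m \<Zsemi> h)) (?s Y)) (VComp (VComp (Lift m) (Lift h)) (?s Y))"
        using h' m 2 by (intro eq_vcomp eq_sym[OF lift_comp] eq_refl) (auto simp: cat_simps)
      also have "cell_eq M \<dots> (VComp (Lift m) (VComp (Lift h) (?s Y)))"
        using h' m 2 by (intro eq_vcomp_assoc) (auto simp: cat_simps)
      finally have sl:
        "cell_eq M (VComp (Lift (m \<Zsemi> h)) (?s Y)) (VComp (Lift m) (VComp (Lift h) (?s Y)))" .
      have "probe U Y (\<lambda>e. q (VComp (VComp (Lift (m \<Zsemi> h)) (?s Y)) e)) =
          probe U Y (\<lambda>e. q (VComp (VComp (Lift m) (VComp (Lift h) (?s Y))) e))"
        using U h' bot[OF mh] by (intro probe_cong observer_precomp_cong[OF q c[OF mh] sl]) auto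
      also have "\<dots> = probe U Y (\<lambda>e. q (VComp (Lift m) (VComp (VComp (Lift h) (?s Y)) e)))"
        using U h' m q closings_Lift[of m] closings_SBullet[OF h 2(2)] 2(1)
        by (intro probe_cong observer_assoc[of P "[]" "[a]" U X]) (auto simp: tensor_obj_unit)
      finally show ?thesis .
    qed
    ultimately show ?thesis
      using 2 tests_precomp[OF 2(2)] by (auto simp: coshift_act intro!: collect_cong)
  qed
qed

section \<open>Interpretation as horizontal composition\<close>

lemma closings_hcomp:
  "\<lbrakk>wf_term M s; e \<in> closings (tm_right s) X\<rbrakk>
    \<Longrightarrow> HComp s e \<in> closings (tm_left s) (tensor_obj M (tm_top M s) X)"
  by (simp add: closings_def)

lemma hcomp_Lift_below:
  assumes "wf_term M s" "e \<in> closings (tm_right s) X" "k \<in> Arr M" "Dom M k = tm_bot M e"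
  shows "cell_eq M (HComp s (VComp e (Lift k))) (VComp (HComp s e) (Lift (whisker (tm_bot M s) k)))"
proof -
  note w = wf_walls[OF assms(1)]
  have e: "wf_term M e" "tm_left e = tm_right s" "tm_right e = []" using assms by (auto simp: closings_def)
  have "cell_eq M (HComp s (VComp e (Lift k))) (HComp (VComp s (HIdent (tm_bot M s))) (VComp e (Lift k)))"
    using assms e w by (intro eq_hcomp eq_refl eq_sym[OF eq_vcomp_ident_right]) auto
  also have "cell_eq M \<dots> (VComp (HComp s e) (HComp (HIdent (tm_bot M s)) (Lift k)))"
    using assms e w by (intro eq_interchange) auto
  also have "cell_eq M \<dots> (VComp (HComp s e) (Lift (whisker (tm_bot M s) k)))"
    using assms e w by (intro eq_vcomp eq_refl eq_sym[OF cell_eq_Lift_whisker]) auto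
  finally show ?thesis .
qed

text \<open>A morphism below \<open>e\<close> becomes, below \<open>HComp s e\<close>, the same
  morphism whiskered by the bottom of \<open>s\<close>; hence the values lie in the shifted
  copresheaf.\<close>

lemma observer_hcomp:
  assumes s: "wf_term M s" and X: "X \<in> Obj M"
    and q: "observer P (tm_left s) (tensor_obj M (tm_top M s) X) q"
  shows "observer (shift (tm_bot M s) P) (tm_right s) X (\<lambda>e. q (HComp s e))"
  unfolding observer_def
proof (intro ballI conjI allI impI)
  fix e assume e: "e \<in> closings (tm_right s) X"
  note se = closings_hcomp[OF s e]
  show "q (HComp s e) \<in> Elts (shift (tm_bot M s) P) (tm_bot M e)"
    using observerD(1)[OF q se] closings_bot[OF e] by simp
  show "q (HComp s e) = q (HComp s e')" if "cell_eq M e e'" for e'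
    using that s e by (intro observerD(2)[OF q se] eq_hcomp) (auto simp: closings_def eq_refl)
  show "q (HComp s (VComp e (Lift k))) = act (shift (tm_bot M s) P) k (q (HComp s e))"
    if k: "k \<in> Arr M" "Dom M k = tm_bot M e" for k
  proof -
    have "VComp e (Lift k) \<in> closings (tm_right s) X"
      using closings_vcomp[OF e, of "Lift k" "[]"] closings_Lift[of k] k by simp
    then have "q (HComp s (VComp e (Lift k))) = q (VComp (HComp s e) (Lift (whisker (tm_bot M s) k)))"
      by (intro observerD(2)[OF q] closings_hcomp hcomp_Lift_below[OF _ e] s e k)
    also have "\<dots> = act P (whisker (tm_bot M s) k) (q (HComp s e))"
      using observerD(3)[OF q se] k wf_walls[OF s] by (simp add: whisker_simps)
    finally show ?thesis using k by simp
  qed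
qed

text \<open>A wall may be probed in its lower part only. The upper part then has an observer with
  values in \<open>along V P\<close>, natural because probes are; vertical composition relies on
  this.\<close>

lemma observer_probe:
  assumes U: "U \<in> walls" and V: "V \<in> walls" and X: "X \<in> Obj M" and P: "is_copresheaf P"
    and q: "observer P (U @ V) X q"
  shows "observer (along V P) U X (\<lambda>d. probe V (tm_bot M d) (\<lambda>e. q (VComp d e)))"
  unfolding observer_def
proof (intro ballI conjI allI impI)
  fix d assume d: "d \<in> closings U X"
  note b = closings_bot[OF d]
  note pn = probe_closed_natural[OF V b P observer_vcomp[OF d q]]
  show "probe V (tm_bot M d) (\<lambda>e. q (VComp d e)) \<in> Elts (along V P) (tm_bot M d)"
    using pn by simp
  show "probe V (tm_bot M d) (\<lambda>e. q (VComp d e)) = probe V (tm_bot M d') (\<lambda>e. q (VComp d' e))"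
    if dd: "cell_eq M d d'" for d'
  proof -
    have "tm_bot M d' = tm_bot M d" using cell_eq_boundaries[OF dd] by simp
    then show ?thesis
      by (auto intro!: probe_cong[OF V b] observer_precomp_cong[OF q d dd])
  qed
  show "probe V (tm_bot M (VComp d (Lift k))) (\<lambda>e. q (VComp (VComp d (Lift k)) e)) =
      act (along V P) k (probe V (tm_bot M d) (\<lambda>e. q (VComp d e)))"
    if k: "k \<in> Arr M" "Dom M k = tm_bot M d" for k
  proof -
    have "probe V (Cod M k) (\<lambda>e. q (VComp (VComp d (Lift k)) e)) =
        probe V (Cod M k) (\<lambda>e. q (VComp d (VComp (Lift k) e)))"
      using k V closings_Lift[of k] q
      by (intro probe_cong observer_assoc[of P U "[]" V X] d) (auto simp: cat_simps)
    then show ?thesis using pn k by simp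
  qed
qed

text \<open>The form in which horizontal yanking is applied: the corners inside a probe carry a
  spare identity on their right.\<close>

lemma cell_eq_hcomp_HIdent:
  assumes "A \<in> Obj M" "wf_term M s" "wf_term M t" "cell_eq M (HComp s t) (HIdent A)" "X \<in> Obj M"
    "tm_right s = tm_left t"
  shows "cell_eq M (HComp s (HComp t (HIdent X))) (HIdent (tensor_obj M A X))"
proof -
  have b: "tm_right t = []" using cell_eq_boundaries[OF assms(4)] by simp
  have "cell_eq M (HComp s (HComp t (HIdent X))) (HComp (HComp s t) (HIdent X))"
    using assms b by (intro eq_sym[OF eq_hcomp_assoc]) auto
  also have "cell_eq M \<dots> (HComp (HIdent A) (HIdent X))"
    using assms b by (intro eq_hcomp eq_refl) auto
  also have "cell_eq M \<dots> (HIdent (tensor_obj M A X))"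
    using assms by (intro eq_hident_mult)
  finally show ?thesis .
qed

lemma vcomp_HIdent_bot:
  "e \<in> closings U X \<Longrightarrow> tm_bot M e = Y \<Longrightarrow> cell_eq M (VComp e (HIdent Y)) e"
  using eq_vcomp_ident_right[of M e] by (simp add: closings_def)

text \<open>Induction on the cell. Probes are built from \<open>RCirc\<close> and
  \<open>SBullet\<close>, so these two need only unit laws and \<open>lift_ident\<close>, while
  \<open>SCirc\<close> and \<open>RBullet\<close> are yanked against them. Horizontal composites use
  associativity, vertical ones interchange.\<close>

lemma interp_probe:
  "\<lbrakk>wf_term M s; is_copresheaf P; X \<in> Obj M;
    observer P (tm_left s) (tensor_obj M (tm_top M s) X) q\<rbrakk> \<Longrightarrow>
    interp s P X (probe (tm_left s) (tensor_obj M (tm_top M s) X) q) =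
    probe (tm_right s) X (\<lambda>e. q (HComp s e))"
proof (induction s arbitrary: P X q)
  case (SCirc A)
  let ?c = "HComp (RCirc A) (HIdent X)"
  have "cell_eq M (HComp (SCirc A) (VComp ?c (HIdent (tensor_obj M A X)))) (HComp (SCirc A) ?c)"
    using SCirc vcomp_HIdent_bot[OF closings_RCirc[of A X]]
    by (intro eq_hcomp eq_refl) (auto simp: cat_simps)
  also have "cell_eq M \<dots> (HIdent (tensor_obj M A X))"
    using SCirc by (intro cell_eq_hcomp_HIdent yank_circ_h) auto
  finally have "cell_eq M (HIdent (tensor_obj M A X))
      (HComp (SCirc A) (VComp ?c (HIdent (tensor_obj M A X))))" by (rule eq_sym)
  then show ?case
    using SCirc by (auto intro!: observerD(2)[of P "[]" "tensor_obj M A X"] HIdent_closings simp: cat_simps)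
next
  case (RCirc A)
  let ?c = "HComp (RCirc A) (HIdent X)"
  have "q (VComp ?c (HIdent (tensor_obj M A X))) = q ?c"
    using RCirc closings_RCirc[of A X]
    by (intro observerD(2)[of P "[(A, Circ)]" X, symmetric]
        eq_sym[OF vcomp_HIdent_bot[OF closings_RCirc[of A X]]])
      (auto simp: cat_simps)
  then show ?case using RCirc by (simp add: cat_simps)
next
  case (SBullet A)
  let ?Y = "tensor_obj M A X" and ?s = "HComp (SBullet A) (HIdent X)"
  have A: "A \<in> Obj M" and X: "X \<in> Obj M" and Y: "?Y \<in> Obj M" using SBullet by (auto simp: cat_simps)
  have t: "(X, Ident M ?Y) \<in> tests A ?Y" using tests_ident[OF A X] .
  have s: "?s \<in> closings [(A, Bullet)] ?Y" using A X by (simp add: closings_def)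
  have "cell_eq M (VComp (VComp (Lift (Ident M ?Y)) ?s) (HIdent X)) (VComp (Lift (Ident M ?Y)) ?s)"
    using A X by (intro vcomp_HIdent_bot[OF closings_SBullet[OF t A]]) (simp add: cat_simps)
  also have "cell_eq M \<dots> (VComp (HIdent ?Y) ?s)"
    using A X Y by (intro eq_vcomp lift_ident eq_refl) (auto simp: cat_simps)
  also have "cell_eq M \<dots> ?s"
    using s eq_vcomp_ident_left[of M ?s] by (simp add: closings_def)
  finally have "cell_eq M ?s (VComp (VComp (Lift (Ident M ?Y)) ?s) (HIdent X))"
    by (rule eq_sym)
  then have "q ?s = q (VComp (VComp (Lift (Ident M ?Y)) ?s) (HIdent X))"
    using SBullet s by (intro observerD(2)[of P "[(A, Bullet)]" ?Y]) auto
  then show ?case using t by simp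
next
  case (RBullet A)
  have A: "A \<in> Obj M" and X: "X \<in> Obj M" and q: "observer P [] X q"
    using RBullet by (auto simp: cat_simps)
  \<comment> \<open>Yanking \<open>RBullet\<close> against the \<open>SBullet\<close> of the probe
    leaves only \<open>Lift h\<close>, and an observer turns \<open>Lift h\<close> into
    \<open>act P h\<close>.\<close>
  have "act P h (q (HIdent X)) =
      q (HComp (RBullet A) (VComp (VComp (Lift h) (HComp (SBullet A) (HIdent Y))) (HIdent Y)))"
    if t: "(Y, h) \<in> tests A X" for Y h
  proof -
    let ?s = "HComp (SBullet A) (HIdent Y)"
    have h: "Y \<in> Obj M" "h \<in> Arr M" "Dom M h = X" "Cod M h = tensor_obj M A Y"
      using t by (auto simp: tests_def)
    have hc: "VComp (Lift h) ?s \<in> closings [(A, Bullet)] X" by (rule closings_SBullet[OF t A])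
    have "cell_eq M (HComp (RBullet A) (VComp (VComp (Lift h) ?s) (HIdent Y)))
        (HComp (RBullet A) (VComp (Lift h) ?s))"
      using A h by (intro eq_hcomp eq_refl vcomp_HIdent_bot[OF hc]) (auto simp: cat_simps)
    also have "cell_eq M \<dots> (HComp (VComp (HIdent (unit_obj M)) (RBullet A)) (VComp (Lift h) ?s))"
      using A h eq_vcomp_ident_left[of M "RBullet A"]
      by (intro eq_hcomp eq_refl eq_sym[of M _ "RBullet A"]) (auto simp: cat_simps)
    also have "cell_eq M \<dots> (VComp (HComp (HIdent (unit_obj M)) (Lift h)) (HComp (RBullet A) ?s))"
      using A h by (intro eq_interchange) (auto simp: cat_simps)
    also have "cell_eq M \<dots> (VComp (Lift h) (HIdent (tensor_obj M A Y)))"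
      using A h cell_eq_Lift_whisker[of "unit_obj M" h]
      by (intro eq_vcomp cell_eq_hcomp_HIdent yank_bullet_h eq_sym[of M "Lift h"])
        (auto simp: cat_simps whisker_unit)
    also have "cell_eq M \<dots> (Lift h)"
      using h eq_vcomp_ident_right[of M "Lift h"] by simp
    also have "cell_eq M \<dots> (VComp (HIdent X) (Lift h))"
      using h eq_vcomp_ident_left[of M "Lift h"] by (intro eq_sym[of M _ "Lift h"]) simp
    finally have *: "cell_eq M (VComp (HIdent X) (Lift h))
        (HComp (RBullet A) (VComp (VComp (Lift h) ?s) (HIdent Y)))" by (rule eq_sym)
    have "act P h (q (HIdent X)) = q (VComp (HIdent X) (Lift h))"
      using observerD(3)[OF q HIdent_closings[OF X]] h by simp
    also have "\<dots> = q (HComp (RBullet A) (VComp (VComp (Lift h) ?s) (HIdent Y)))"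
      using X h by (intro observerD(2)[OF q _ *]) (auto simp: closings_def cat_simps)
    finally show ?thesis .
  qed
  then show ?case using X by (auto simp: cat_simps intro!: collect_cong)
next
  case (Lift f)
  let ?Y = "tensor_obj M (Dom M f) X" and ?f = "tensor_arr M f (Ident M X)"
  have f: "f \<in> Arr M" and X: "X \<in> Obj M" and q: "observer P [] ?Y q" using Lift by auto
  have Y: "?Y \<in> Obj M" using f X by (simp add: cat_simps)
  have "cell_eq M (VComp (HIdent ?Y) (Lift ?f)) (Lift ?f)"
    using f X eq_vcomp_ident_left[of M "Lift ?f"] by (simp add: cat_simps)
  also have "cell_eq M \<dots> (HComp (Lift f) (Lift (Ident M X)))"
    using f X by (intro eq_sym[OF lift_tensor]) (auto simp: cat_simps)
  also have "cell_eq M \<dots> (HComp (Lift f) (HIdent X))"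
    using f X by (intro eq_hcomp eq_refl lift_ident) (auto simp: cat_simps)
  finally have *: "cell_eq M (VComp (HIdent ?Y) (Lift ?f)) (HComp (Lift f) (HIdent X))" .
  have "act P ?f (q (HIdent ?Y)) = q (VComp (HIdent ?Y) (Lift ?f))"
    using observerD(3)[OF q HIdent_closings[OF Y]] f X by (simp add: cat_simps)
  also have "\<dots> = q (HComp (Lift f) (HIdent X))"
    using f X Y by (intro observerD(2)[OF q _ *]) (auto simp: closings_def cat_simps)
  finally show ?case by simp
next
  case (HIdent A)
  then show ?case
    using eq_sym[OF eq_hident_mult[of A M X]]
    by (auto intro!: observerD(2)[of P "[]" "tensor_obj M A X"] HIdent_closings simp: cat_simps)
next
  case (VIdent U)
  have "q e = q (HComp (VIdent U) e)" if "e \<in> closings U X" for e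
    using that eq_sym[OF eq_hcomp_ident_left[of M e]] VIdent
    by (intro observerD(2)[of P U X]) (auto simp: closings_def cat_simps)
  then show ?case using VIdent
    by (auto simp: cat_simps exchange_monoid_def intro!: probe_cong)
next
  case (HComp s t)
  then have wf: "wf_term M s" "wf_term M t" and st: "tm_right s = tm_left t" by auto
  note w = wf_walls[OF wf(1)] wf_walls[OF wf(2)]
  let ?T = "tensor_obj M (tm_top M t) X"
  have T: "?T \<in> Obj M" using w HComp.prems by (simp add: cat_simps)
  have q: "observer P (tm_left s) (tensor_obj M (tm_top M s) ?T) q"
    using HComp.prems w by (simp add: cat_simps)
  have sq: "observer (shift (tm_bot M s) P) (tm_left t) ?T (\<lambda>e. q (HComp s e))"
    using observer_hcomp[OF wf(1) T q] st by simp
  have "interp (HComp s t) P X (probe (tm_left s) (tensor_obj M (tm_top M s) ?T) q) =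
      interp t (shift (tm_bot M s) P) X (probe (tm_left t) ?T (\<lambda>e. q (HComp s e)))"
    using HComp.IH(1)[OF wf(1) HComp.prems(2) T q] st by simp
  also have "\<dots> = probe (tm_right t) X (\<lambda>e. q (HComp s (HComp t e)))"
    using HComp.prems w sq by (intro HComp.IH(2) is_copresheaf_shift wf) auto
  also have "\<dots> = probe (tm_right t) X (\<lambda>e. q (HComp (HComp s t) e))"
  proof (rule probe_cong[OF w(6) HComp.prems(3)])
    fix e assume e: "e \<in> closings (tm_right t) X"
    have "HComp (HComp s t) e \<in> closings (tm_left s) (tensor_obj M (tm_top M s) ?T)"
      using e wf st HComp.prems w by (simp add: closings_def cat_simps)
    then have "q (HComp (HComp s t) e) = q (HComp s (HComp t e))"
      using e wf st by (intro observerD(2)[OF q] eq_hcomp_assoc) (auto simp: closings_def)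
    then show "q (HComp s (HComp t e)) = q (HComp (HComp s t) e)" by simp
  qed
  finally show ?case using w HComp.prems by (simp add: cat_simps)
next
  case (VComp s t)
  then have wf: "wf_term M s" "wf_term M t" and st: "tm_bot M s = tm_top M t" by auto
  note w = wf_walls[OF wf(1)] wf_walls[OF wf(2)]
  let ?U = "tm_left s" and ?U' = "tm_left t" and ?V = "tm_right s" and ?V' = "tm_right t"
  let ?Y = "tensor_obj M (tm_top M s) X"
  \<comment> \<open>The left wall of \<open>t\<close> is probed below each closing of the left wall
    of \<open>s\<close>; this is the observer to which the hypothesis for \<open>s\<close>
    applies.\<close>
  let ?q = "\<lambda>d. probe ?U' (tm_bot M d) (\<lambda>e. q (VComp d e))"
  have X: "X \<in> Obj M" and Y: "?Y \<in> Obj M" using VComp.prems w by (auto simp: cat_simps)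
  have P': "is_copresheaf (along ?U' P)" using VComp.prems w by (auto intro: is_copresheaf_along)
  have q: "observer P (?U @ ?U') ?Y q" using VComp.prems by simp
  have q': "observer (along ?U' P) ?U ?Y ?q"
    using w Y VComp.prems q by (intro observer_probe)
  have "interp (VComp s t) P X (probe (?U @ ?U') ?Y q) =
      along_map ?V (interp t P) X (interp s (along ?U' P) X (probe ?U ?Y ?q))"
    using probe_append[OF w(1) w(5) Y q] by simp
  also have "\<dots> = along_map ?V (interp t P) X (probe ?V X (\<lambda>d. ?q (HComp s d)))"
    using VComp.IH(1)[OF wf(1) P' X q'] by simp
  also have "\<dots> = probe ?V X (\<lambda>d. interp t P (tm_bot M d) (?q (HComp s d)))"
    by (rule along_map_probe)
  also have "\<dots> = probe ?V X (\<lambda>d. probe ?V' (tm_bot M d) (\<lambda>e. q (HComp (VComp s t) (VComp d e))))"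
  proof (rule probe_cong[OF w(2) X])
    fix d assume d: "d \<in> closings ?V X"
    note sd = closings_hcomp[OF wf(1) d]
    have "interp t P (tm_bot M d) (?q (HComp s d)) =
        probe ?V' (tm_bot M d) (\<lambda>e. q (VComp (HComp s d) (HComp t e)))"
      using VComp.IH(2)[OF wf(2) VComp.prems(2) closings_bot[OF d]] observer_vcomp[OF sd q] st
      by simp
    also have "\<dots> = probe ?V' (tm_bot M d) (\<lambda>e. q (HComp (VComp s t) (VComp d e)))"
    proof (rule probe_cong[OF w(6) closings_bot[OF d]])
      fix e assume e: "e \<in> closings ?V' (tm_bot M d)"
      have "HComp (VComp s t) (VComp d e) \<in> closings (?U @ ?U') ?Y"
        using d e wf st by (simp add: closings_def)
      then have "q (HComp (VComp s t) (VComp d e)) = q (VComp (HComp s d) (HComp t e))"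
        using d e wf st by (intro observerD(2)[OF q] eq_interchange) (auto simp: closings_def)
      then show "q (VComp (HComp s d) (HComp t e)) = q (HComp (VComp s t) (VComp d e))" by simp
    qed
    finally show "interp t P (tm_bot M d) (?q (HComp s d)) =
        probe ?V' (tm_bot M d) (\<lambda>e. q (HComp (VComp s t) (VComp d e)))" .
  qed
  also have "\<dots> = probe (?V @ ?V') X (\<lambda>e. q (HComp (VComp s t) e))"
    using observer_hcomp[OF VComp.prems(1,3,4)] w X by (intro probe_append[symmetric]) auto
  finally show ?case by simp
qed

section \<open>Fullness\<close>

text \<open>A closing of the empty wall has both side boundaries trivial, so the elements at
  \<open>X\<close> are the vertical cells from \<open>A\<close> to \<open>X\<close>, again stored as
  constant functions.\<close>

definition vertical_cells :: "'o \<Rightarrow> ('o, 'a, ('o, 'a) cell_term set) copresheaf" where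
  "vertical_cells A =
    \<lparr>Elts = (\<lambda>X. {\<lambda>l. cell_class M e |e. e \<in> closings [] A \<and> tm_bot M e = X}),
     act = (\<lambda>m. if m \<in> Arr M then (\<lambda>x l. cell_class M (VComp (cell_rep (x l)) (Lift m)))
       else undefined)\<rparr>"

lemma cell_class_cong: "cell_eq M s t \<Longrightarrow> cell_class M s = cell_class M t"
  using cell_class_eq_iff cell_eq_boundaries by blast

lemma cell_class_vcomp_rep:
  assumes "wf_term M (VComp s t)"
  shows "cell_class M (VComp (cell_rep (cell_class M s)) t) = cell_class M (VComp s t)"
proof -
  have "cell_eq M (VComp s t) (VComp (cell_rep (cell_class M s)) t)"
    using assms by (intro eq_vcomp cell_rep_eq eq_refl) auto
  then show ?thesis by (rule cell_class_cong[symmetric])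
qed

lemma vertical_cells_act:
  assumes "e \<in> closings U X" "m \<in> Arr M" "Dom M m = tm_bot M e"
  shows "act (vertical_cells A) m (\<lambda>l. cell_class M e) = (\<lambda>l. cell_class M (VComp e (Lift m)))"
  using assms by (simp add: vertical_cells_def closings_def cell_class_vcomp_rep)

lemma vertical_cells_eltE:
  assumes "x \<in> Elts (vertical_cells A) X"
  obtains e where "x = (\<lambda>l. cell_class M e)" "e \<in> closings [] A" "tm_bot M e = X"
  using assms by (auto simp: vertical_cells_def)

lemma vertical_cells_eltI:
  "e \<in> closings [] A \<Longrightarrow> tm_bot M e = X \<Longrightarrow> (\<lambda>l. cell_class M e) \<in> Elts (vertical_cells A) X"
  by (auto simp: vertical_cells_def)

lemma closings_vcomp_Lift:
  "\<lbrakk>e \<in> closings U X; m \<in> Arr M; Dom M m = tm_bot M e\<rbrakk> \<Longrightarrow> VComp e (Lift m) \<in> closings U X"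
  by (simp add: closings_def)

lemma is_copresheaf_vertical_cells: "is_copresheaf (vertical_cells A)"
  unfolding is_copresheaf_def
proof (intro conjI allI ballI impI)
  fix X assume "X \<notin> Obj M" then show "Elts (vertical_cells A) X = {}"
    using closings_bot by (auto simp: vertical_cells_def)
next
  fix m assume "m \<notin> Arr M" then show "act (vertical_cells A) m = undefined"
    by (simp add: vertical_cells_def)
next
  fix m x assume m: "m \<in> Arr M" and x: "x \<in> Elts (vertical_cells A) (Dom M m)"
  from x obtain e where e: "x = (\<lambda>l. cell_class M e)" "e \<in> closings [] A" "tm_bot M e = Dom M m"
    by (rule vertical_cells_eltE)
  then show "act (vertical_cells A) m x \<in> Elts (vertical_cells A) (Cod M m)"
    using m by (auto simp: vertical_cells_act closings_vcomp_Lift intro!: vertical_cells_eltI)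
next
  fix X x assume X: "X \<in> Obj M" and x: "x \<in> Elts (vertical_cells A) X"
  from x obtain e where e: "x = (\<lambda>l. cell_class M e)" "e \<in> closings [] A" "tm_bot M e = X"
    by (rule vertical_cells_eltE)
  have "cell_eq M (VComp e (Lift (Ident M X))) (VComp e (HIdent X))"
    using e X by (intro eq_vcomp eq_refl lift_ident) (auto simp: closings_def cat_simps)
  also have "cell_eq M \<dots> e" using e by (intro vcomp_HIdent_bot)
  finally show "act (vertical_cells A) (Ident M X) x = x"
    using e X by (simp add: vertical_cells_act cat_simps cell_class_cong)
next
  fix m n x assume mn: "m \<in> Arr M" "n \<in> Arr M" "Cod M m = Dom M n"
    and x: "x \<in> Elts (vertical_cells A) (Dom M m)"
  from x obtain e where e: "x = (\<lambda>l. cell_class M e)" "e \<in> closings [] A" "tm_bot M e = Dom M m"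
    by (rule vertical_cells_eltE)
  have "cell_eq M (VComp e (Lift (m \<Zsemi> n))) (VComp e (VComp (Lift m) (Lift n)))"
    using e mn by (intro eq_vcomp eq_refl eq_sym[OF lift_comp]) (auto simp: closings_def cat_simps)
  also have "cell_eq M \<dots> (VComp (VComp e (Lift m)) (Lift n))"
    using e mn by (intro eq_sym[OF eq_vcomp_assoc]) (auto simp: closings_def cat_simps)
  finally show "act (vertical_cells A) (m \<Zsemi> n) x =
      act (vertical_cells A) n (act (vertical_cells A) m x)"
    using e mn vertical_cells_act[OF closings_vcomp_Lift[OF e(2)], of m n]
    by (simp add: vertical_cells_act cat_simps cell_class_cong)
qed

text \<open>The tautological observer, for which \<open>interp_probe\<close> speaks of cells
  themselves.\<close>

lemma observer_cell_class: "observer (vertical_cells A) [] A (\<lambda>e l. cell_class M e)"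
  unfolding observer_def
  by (auto simp: vertical_cells_eltI vertical_cells_act cell_class_cong)

text \<open>The comparison transformation along which the interpretation of a vertical cell is
  transported from the representable.\<close>

lemma natural_Lift:
  "natural (representable A) (vertical_cells A) (\<lambda>X x l. cell_class M (Lift (x l)))"
  unfolding natural_def
proof (intro conjI ballI)
  fix X x assume "x \<in> Elts (representable A) X"
  then show "(\<lambda>l. cell_class M (Lift (x l))) \<in> Elts (vertical_cells A) X"
    by (auto simp: representable_def closings_def intro!: vertical_cells_eltI)
next
  fix m x assume m: "m \<in> Arr M" and "x \<in> Elts (representable A) (Dom M m)"
  then obtain f where f: "x = (\<lambda>l. f)" "f \<in> Arr M" "Dom M f = A" "Cod M f = Dom M m"
    by (auto simp: representable_def)
  then show "(\<lambda>l. cell_class M (Lift (act (representable A) m x l))) =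
      act (vertical_cells A) m (\<lambda>l. cell_class M (Lift (x l)))"
    using m vertical_cells_act[OF closings_Lift[of f] m, of A]
    by (simp add: representable_def cell_class_cong[OF lift_comp])
qed

lemma Lift_full:
  assumes s: "wf_term M s" "tm_left s = []" "tm_right s = []"
  obtains f where "f \<in> Arr M" "cell_eq M s (Lift f)"
proof -
  let ?A = "tm_top M s" and ?I = "unit_obj M"
  note w = wf_walls[OF s(1)]
  let ?q = "\<lambda>e (l :: ('o \<times> 'a) list). cell_class M e"
  let ?x = "\<lambda>l :: ('o \<times> 'a) list. Ident M ?A"
  \<comment> \<open>At the unit object and with empty side walls, both probes reduce to evaluation
    at an identity cell.\<close>
  have "interp s (vertical_cells ?A) ?I (probe (tm_left s) (tensor_obj M ?A ?I) ?q) =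
      probe (tm_right s) ?I (\<lambda>e. ?q (HComp s e))"
    using s w observer_cell_class[of ?A]
    by (intro interp_probe is_copresheaf_vertical_cells) (auto simp: cat_simps)
  then have "interp s (vertical_cells ?A) ?I (?q (HIdent ?A)) = ?q (HComp s (HIdent ?I))"
    using s w by (simp add: cat_simps)
  also have "\<dots> = ?q s"
  proof -
    have "cell_eq M (HComp s (HIdent ?I)) (HComp s (VIdent []))"
      using s by (intro eq_hcomp eq_refl eq_ident_one) (auto simp: cat_simps)
    also have "cell_eq M \<dots> s" using eq_hcomp_ident_right[OF s(1)] s by simp
    finally show ?thesis by (simp add: cell_class_cong)
  qed
  finally have 1: "interp s (vertical_cells ?A) ?I (?q (HIdent ?A)) = ?q s" .
  have x: "?x \<in> Elts (along (tm_left s) (representable ?A)) (tensor_obj M ?A ?I)"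
    using s w ident_arr[of ?A] by (auto simp: representable_def cat_simps)
  have "interp s (representable ?A) ?I ?x \<in> Elts (representable ?A) (tm_bot M s)"
    using interp_closed[OF s(1) is_copresheaf_representable _ x] s w by (simp add: cat_simps)
  \<comment> \<open>The witness is the value of the interpretation of \<open>s\<close> at the
    universal element.\<close>
  then obtain f where f: "interp s (representable ?A) ?I ?x = (\<lambda>l. f)" "f \<in> Arr M"
    by (auto simp: representable_def)
  \<comment> \<open>The comparison sends the universal element to the class of
    \<open>Lift (Ident M ?A)\<close>, which is the identity cell, so this computes the class of
    \<open>s\<close> a second time.\<close>
  have "interp s (vertical_cells ?A) ?I (\<lambda>l. cell_class M (Lift (?x l))) =
      (\<lambda>l. cell_class M (Lift (interp s (representable ?A) ?I ?x l)))"
    using interp_along_map[OF s(1) is_copresheaf_representable is_copresheaf_vertical_cells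
        natural_Lift unit_obj_closed x] s w
    by simp
  then have "?q s = (\<lambda>l. cell_class M (Lift f))"
    using 1 f w cell_class_cong[OF lift_ident[of ?A M]] by simp
  then have "cell_class M s = cell_class M (Lift f)" by meson
  then have "cell_eq M s (Lift f)" using cell_class_eq_iff[OF s(1)] by simp
  then show thesis using f(2) that by blast
qed

end

section \<open>The isomorphism of categories\<close>

text \<open>The inverse of a bijective functor preserves identities and composites by injectivity on
  arrows. The functor runs from \<open>D\<close> to \<open>C\<close> since the explicit one, given
  by \<open>Lift\<close>, starts at \<open>M\<close>.\<close>

lemma isomorphic_categoriesI:
  assumes F: "category_functor D C Fo Fa"
    and "bij_betw Fo (Obj D) (Obj C)" "bij_betw Fa (Arr D) (Arr C)"
  shows "isomorphic_categories C D"
proof -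
  interpret F: category_functor D C Fo Fa by (rule F)
  let ?Go = "inv_into (Obj D) Fo" and ?Ga = "inv_into (Arr D) Fa"
  have o: "\<And>A. A \<in> Obj C \<Longrightarrow> ?Go A \<in> Obj D \<and> Fo (?Go A) = A"
    "\<And>A. A \<in> Obj D \<Longrightarrow> ?Go (Fo A) = A"
    using assms(2) by (auto simp: bij_betw_def inv_into_into f_inv_into_f)
  have a: "\<And>f. f \<in> Arr C \<Longrightarrow> ?Ga f \<in> Arr D \<and> Fa (?Ga f) = f"
    "\<And>f. f \<in> Arr D \<Longrightarrow> ?Ga (Fa f) = f"
    using assms(3) by (auto simp: bij_betw_def inv_into_into f_inv_into_f)
  have d: "Dom D (?Ga f) = ?Go (Dom C f)" "Cod D (?Ga f) = ?Go (Cod C f)" if "f \<in> Arr C" for f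
    using a(1)[OF that] o(2) F.map_dom F.map_cod F.C.dom_obj F.C.cod_obj by metis+
  have "category_functor C D ?Go ?Ga"
  proof
    show "?Ga (Ident C A) = Ident D (?Go A)" if "A \<in> Obj C" for A
      using o(1)[OF that] a(2) F.map_ident F.C.ident_arr by metis
    show "?Ga (f \<Zsemi>\<^bsub>C\<^esub> g) = ?Ga f \<Zsemi>\<^bsub>D\<^esub> ?Ga g"
      if "f \<in> Arr C" "g \<in> Arr C" "Cod C f = Dom C g" for f g
    proof -
      have "Cod D (?Ga f) = Dom D (?Ga g)" using d that by simp
      then have "Fa (?Ga f \<Zsemi>\<^bsub>D\<^esub> ?Ga g) = f \<Zsemi>\<^bsub>C\<^esub> g" "?Ga f \<Zsemi>\<^bsub>D\<^esub> ?Ga g \<in> Arr D"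
        using a(1) that F.map_comp F.C.comp_arr by auto
      then show ?thesis using a(2) by metis
    qed
  qed (simp_all add: o a d)
  then show ?thesis
    unfolding isomorphic_categories_def using F o a by blast
qed

context symmetric_strict_monoidal_category
begin

lemma isomorphic_vertical_category_free_cornering:
  "isomorphic_categories (vertical_category (free_cornering M)) M"
proof (rule isomorphic_categoriesI)
  let ?V = "vertical_category (free_cornering M)" and ?F = "\<lambda>f. cell_class M (Lift f)"
  interpret D: single_object_double_category "free_cornering M"
    by (rule single_object_double_category_free_cornering)
  interpret V: strict_monoidal_category ?V
    by (rule D.strict_monoidal_vertical_category)
  have obj: "Obj ?V = Obj M"
    by (simp add: vertical_category_def free_cornering_simps object_monoid_def)
  have arr: "Arr ?V = {c \<in> cells (free_cornering M).
      left_edge (free_cornering M) c = [] \<and> right_edge (free_cornering M) c = []}"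
    by (simp add: vertical_category_def free_cornering_simps exchange_monoid_def)
  note simps = free_cornering_simps vertical_category_def
  show "category_functor M ?V (\<lambda>A. A) ?F"
  proof
    show "?F f \<in> Arr ?V" if "f \<in> Arr M" for f
      unfolding arr using that by (simp add: free_cornering_simps)
    show "?F (f \<Zsemi> g) = ?F f \<Zsemi>\<^bsub>?V\<^esub> ?F g" if "f \<in> Arr M" "g \<in> Arr M" "Cod M f = Dom M g" for f g
      using that by (simp add: simps cell_class_cong[OF lift_comp])
  qed (simp_all add: obj, simp_all add: simps cell_class_cong[OF lift_ident])
  show "bij_betw (\<lambda>A. A) (Obj M) (Obj ?V)"
    by (simp add: obj bij_betw_def)
  show "bij_betw ?F (Arr M) (Arr ?V)"
    unfolding bij_betw_def
  proof
    show "inj_on ?F (Arr M)"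
      by (auto intro!: inj_onI Lift_faithful simp: cell_class_eq_iff)
    show "?F ` Arr M = Arr ?V"
    proof
      show "?F ` Arr M \<subseteq> Arr ?V" unfolding arr by (auto simp: free_cornering_simps)
      show "Arr ?V \<subseteq> ?F ` Arr M"
      proof
        fix c assume c: "c \<in> Arr ?V"
        then obtain s where s: "wf_term M s" "c = cell_class M s"
          unfolding arr by (auto elim: free_cornering_cellE)
        then have "tm_left s = []" "tm_right s = []"
          using c unfolding arr by (auto simp: free_cornering_simps)
        then obtain f where "f \<in> Arr M" "cell_eq M s (Lift f)"
          using Lift_full s(1) by blast
        then show "c \<in> ?F ` Arr M" using s(2) cell_class_cong by blast
      qed
    qed
  qed
qed

end

theorem proposition4p4:
  fixes \<A> :: "('o, 'a) symmetric_monoidal_category"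
  assumes "symmetric_strict_monoidal_category \<A>"
  shows "isomorphic_categories (vertical_category (free_cornering \<A>)) \<A>"
  using assms by (rule symmetric_strict_monoidal_category.isomorphic_vertical_category_free_cornering)

end
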